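(* Let $p\in(1,\infty)$, let $\mu_1,\dots,\mu_N\in\mathcal P(\Omega)$ and let $(\lambda_i)_{i\in[N]}\in\Delta_N$. Let $(\varphi_i)_{i\in[N]}\in\mathcal B_{\bar c}$ and let $\gamma\in\Pi$. The following are equivalent: (1) $\gamma$ is a minimizer of $\mathrm{wMM}(\mu_1,\dots,\mu_N)$ and $(\varphi_i)_{i\in[N]}$ is a maximizer of $\mathrm{wDr}(\mu_1,\dots,\mu_N)$. (2) For $\gamma$-a.e. $(x_1,\dots,x_N)\in\Omega^N$, $$\sum_{i=1}^N\varphi_i(x_i)=\bar c(x_1,\dots,x_N),$$ and for all $i\in[N]$, $$\int_\Omega\varphi_i(x_i)\,d(\pi_{i\#}\gamma)(x_i)=\int_\Omega\varphi_i(x_i)\,d\mu_i(x_i).$$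
   Context: $\Omega\subset\mathbb R^d$ is a fixed compact convex set, $\mathcal P(\Omega)$ is the set of Borel probability measures on $\Omega$, and $0\le M\le N$ are fixed integers with $N>0$. $[N]=\{1,\dots,N\}$ and $\Delta_N=\{(\lambda_i)_{i\in[N]}\in(0,1)^N:\sum_{i=1}^N\lambda_i=1\}$. Convex order: for $\eta,\mu\in\mathcal P(\Omega)$, $\eta\le_{cx}\mu$ means $\int_\Omega\varphi\,d\eta\le\int_\Omega\varphi\,d\mu$ for all convex $\varphi:\mathbb R^d\to\mathbb R$. With $\pi_i:\Omega^N\to\Omega$ the projection on the $i$-th factor and $\#$ denoting pushforward, set $$\Pi:=\{\gamma\in\mathcal P(\Omega^N):\ \mu_i\le_{cx}\pi_{i\#}\gamma\ \text{for } i=1,\dots,M;\ \ \pi_{i\#}\gamma\le_{cx}\mu_i\ \text{for } i=M+1,\dots,N\}.$$ Infimal convolution cost: $\bar c(x_1,\dots,x_N)=\inf_{z\in\Omega}\sum_{i=1}^N\lambda_i|x_i-z|^p$ for $(x_1,\dots,x_N)\in\Omega^N$. Multi-marginal problem: $\mathrm{wMM}(\mu_1,\dots,\mu_N)=\inf_{\gamma\in\Pi}\int_{\Omega^N}\bar c\,d\gamma$. Relaxed dual problem: for $i=M+1,\dots,N$ let $K_i=\mathrm{conv}(\mathrm{supp}(\mu_i))$. Then $$\mathrm{wDr}(\mu_1,\dots,\mu_N)=\sup_{(\varphi_i)\in\mathcal B_{\bar c}}\ \sum_{i=1}^M\int_\Omega\varphi_i\,d\mu_i+\sum_{i=M+1}^N\int_{K_i}\varphi_i\,d\mu_i,$$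 where $\mathcal B_{\bar c}$ is the set of $(\varphi_i)_{i\in[N]}$ such that: $\varphi_i:\Omega\to\mathbb R$ is convex and continuous for $i=1,\dots,M$; $\varphi_i:K_i\to\mathbb R\cup\{-\infty\}$ is concave, upper semicontinuous and in $L^1(\mu_i)$ for $i=M+1,\dots,N$; and $\sum_{i=1}^N\varphi_i(x_i)\le\bar c(x_1,\dots,x_N)$ for all $(x_1,\dots,x_N)\in\Omega^M\times K_{M+1}\times\dots\times K_N$. Convention: for $i=M+1,\dots,N$, where $\varphi_i$ is defined only on $K_i$, integrals of $\varphi_i$ over $\Omega$ against $\mu_i$ or $\pi_{i\#}\gamma$ are understood as integrals over $K_i$ (both measures are concentrated on $K_i$). *)

theory Defs
  imports "HOL-Probability.Probability"
begin

definition borel_probs :: "'a::topological_space set \<Rightarrow> 'a measure set" where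
  "borel_probs \<Omega> = {\<mu>. prob_space \<mu> \<and> sets \<mu> = sets (restrict_space borel \<Omega>)}"

text \<open>\<open>\<Omega>\<^sup>N\<close> is modelled by the extensional functions \<open>{1..N} \<rightarrow>\<^sub>E \<Omega>\<close>. As Euclidean spaces are
  second countable, the product sigma-algebra below is the Borel sigma-algebra of \<open>\<Omega>\<^sup>N\<close>.\<close>

definition borel_probs_prod :: "'a::topological_space set \<Rightarrow> nat \<Rightarrow> (nat \<Rightarrow> 'a) measure set" where
  "borel_probs_prod \<Omega> N =
    {\<gamma>. prob_space \<gamma> \<and> sets \<gamma> = sets (PiM {1..N} (\<lambda>_. restrict_space borel \<Omega>))}"

definition marginal :: "'a::topological_space set \<Rightarrow> nat \<Rightarrow> (nat \<Rightarrow> 'a) measure \<Rightarrow> 'a measure" where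
  "marginal \<Omega> i \<gamma> = distr \<gamma> (restrict_space borel \<Omega>) (\<lambda>x. x i)"

text \<open>The measures have carrier \<open>\<Omega>\<close>, so the integrals are integrals over \<open>\<Omega>\<close>.\<close>

definition cx_le :: "'a::euclidean_space measure \<Rightarrow> 'a measure \<Rightarrow> bool" where
  "cx_le \<eta> \<mu> \<longleftrightarrow> (\<forall>f :: 'a \<Rightarrow> real. convex_on UNIV f \<longrightarrow> (\<integral>x. f x \<partial>\<eta>) \<le> (\<integral>x. f x \<partial>\<mu>))"

definition plans ::
  "'a::euclidean_space set \<Rightarrow> nat \<Rightarrow> nat \<Rightarrow> (nat \<Rightarrow> 'a measure) \<Rightarrow> (nat \<Rightarrow> 'a) measure set" where
  "plans \<Omega> M N \<mu> = {\<gamma> \<in> borel_probs_prod \<Omega> N.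
     (\<forall>i\<in>{1..M}. cx_le (\<mu> i) (marginal \<Omega> i \<gamma>)) \<and>
     (\<forall>i\<in>{M+1..N}. cx_le (marginal \<Omega> i \<gamma>) (\<mu> i))}"

definition cbar ::
  "'a::euclidean_space set \<Rightarrow> nat \<Rightarrow> (nat \<Rightarrow> real) \<Rightarrow> real \<Rightarrow> (nat \<Rightarrow> 'a) \<Rightarrow> real" where
  "cbar \<Omega> N w p x = (INF z\<in>\<Omega>. \<Sum>i=1..N. w i * norm (x i - z) powr p)"

definition wMM ::
  "'a::euclidean_space set \<Rightarrow> nat \<Rightarrow> nat \<Rightarrow> (nat \<Rightarrow> real) \<Rightarrow> real \<Rightarrow> (nat \<Rightarrow> 'a measure) \<Rightarrow> ereal" where
  "wMM \<Omega> M N w p \<mu> = (INF \<gamma>\<in>plans \<Omega> M N \<mu>. ereal (\<integral>x. cbar \<Omega> N w p x \<partial>\<gamma>))"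

definition wMM_minimizer ::
  "'a::euclidean_space set \<Rightarrow> nat \<Rightarrow> nat \<Rightarrow> (nat \<Rightarrow> real) \<Rightarrow> real \<Rightarrow> (nat \<Rightarrow> 'a measure)
    \<Rightarrow> (nat \<Rightarrow> 'a) measure \<Rightarrow> bool" where
  "wMM_minimizer \<Omega> M N w p \<mu> \<gamma> \<longleftrightarrow>
     \<gamma> \<in> plans \<Omega> M N \<mu> \<and> ereal (\<integral>x. cbar \<Omega> N w p x \<partial>\<gamma>) = wMM \<Omega> M N w p \<mu>"

definition measure_supp :: "'a::topological_space measure \<Rightarrow> 'a set" where
  "measure_supp \<mu> =
    {x \<in> space \<mu>. \<forall>U. open U \<longrightarrow> x \<in> U \<longrightarrow> emeasure \<mu> (U \<inter> space \<mu>) > 0}"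

text \<open>The domain of the \<open>i\<close>-th potential: \<open>\<Omega>\<close> for \<open>i \<le> M\<close> and \<open>K\<^sub>i\<close> for \<open>i > M\<close>.\<close>

definition pot_dom :: "'a::euclidean_space set \<Rightarrow> nat \<Rightarrow> (nat \<Rightarrow> 'a measure) \<Rightarrow> nat \<Rightarrow> 'a set" where
  "pot_dom \<Omega> M \<mu> i = (if i \<le> M then \<Omega> else convex hull (measure_supp (\<mu> i)))"

text \<open>Integral over \<open>A\<close> of an extended real function: positive part minus negative part
  (\<open>e2ennreal\<close> truncates at 0). It is meaningful if one of the two parts is finite; in particular
  it is \<open>-\<infinity>\<close> if only the negative part is infinite.\<close>

definition ereal_integral_on :: "'a set \<Rightarrow> ('a \<Rightarrow> ereal) \<Rightarrow> 'a measure \<Rightarrow> ereal" where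
  "ereal_integral_on A f \<mu> =
     enn2ereal (\<integral>\<^sup>+x\<in>A. e2ennreal (f x) \<partial>\<mu>) - enn2ereal (\<integral>\<^sup>+x\<in>A. e2ennreal (- f x) \<partial>\<mu>)"

definition ereal_L1_on :: "'a set \<Rightarrow> ('a \<Rightarrow> ereal) \<Rightarrow> 'a measure \<Rightarrow> bool" where
  "ereal_L1_on A f \<mu> \<longleftrightarrow>
     f \<in> borel_measurable (restrict_space \<mu> A) \<and> (\<integral>\<^sup>+x\<in>A. e2ennreal \<bar>f x\<bar> \<partial>\<mu>) < \<infinity>"

text \<open>Only used for functions without the value \<open>\<infinity>\<close>, so that the sum below is unambiguous.\<close>

definition ereal_concave_on :: "'a::real_vector set \<Rightarrow> ('a \<Rightarrow> ereal) \<Rightarrow> bool" where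
  "ereal_concave_on A f \<longleftrightarrow> convex A \<and>
     (\<forall>x\<in>A. \<forall>y\<in>A. \<forall>t\<in>{0<..<1::real}.
        ereal (1 - t) * f x + ereal t * f y \<le> f ((1 - t) *\<^sub>R x + t *\<^sub>R y))"

definition ereal_usc_on :: "'a::topological_space set \<Rightarrow> ('a \<Rightarrow> ereal) \<Rightarrow> bool" where
  "ereal_usc_on A f \<longleftrightarrow> (\<forall>x\<in>A. Limsup (at x within A) f \<le> f x)"

text \<open>A family of potentials is one function \<open>\<phi> :: nat \<Rightarrow> 'a \<Rightarrow> ereal\<close>; the values of \<open>\<phi> i\<close>
  outside \<open>pot_dom \<Omega> M \<mu> i\<close>, and all \<open>\<phi> i\<close> with \<open>i \<notin> {1..N}\<close>, are irrelevant.\<close>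

definition dual_admissible ::
  "'a::euclidean_space set \<Rightarrow> nat \<Rightarrow> nat \<Rightarrow> (nat \<Rightarrow> real) \<Rightarrow> real \<Rightarrow> (nat \<Rightarrow> 'a measure)
    \<Rightarrow> (nat \<Rightarrow> 'a \<Rightarrow> ereal) set" where
  "dual_admissible \<Omega> M N w p \<mu> = {\<phi>.
     (\<forall>i\<in>{1..M}. \<exists>f :: 'a \<Rightarrow> real. convex_on \<Omega> f \<and> continuous_on \<Omega> f \<and>
        (\<forall>x\<in>\<Omega>. \<phi> i x = ereal (f x))) \<and>
     (\<forall>i\<in>{M+1..N}.
        (\<forall>x\<in>pot_dom \<Omega> M \<mu> i. \<phi> i x \<noteq> \<infinity>) \<and>
        ereal_concave_on (pot_dom \<Omega> M \<mu> i) (\<phi> i) \<and>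
        ereal_usc_on (pot_dom \<Omega> M \<mu> i) (\<phi> i) \<and>
        ereal_L1_on (pot_dom \<Omega> M \<mu> i) (\<phi> i) (\<mu> i)) \<and>
     (\<forall>x \<in> (\<Pi>\<^sub>E i\<in>{1..N}. pot_dom \<Omega> M \<mu> i).
        (\<Sum>i=1..N. \<phi> i (x i)) \<le> ereal (cbar \<Omega> N w p x))}"

definition dual_value ::
  "'a::euclidean_space set \<Rightarrow> nat \<Rightarrow> nat \<Rightarrow> (nat \<Rightarrow> 'a measure) \<Rightarrow> (nat \<Rightarrow> 'a \<Rightarrow> ereal) \<Rightarrow> ereal" where
  "dual_value \<Omega> M N \<mu> \<phi> = (\<Sum>i=1..N. ereal_integral_on (pot_dom \<Omega> M \<mu> i) (\<phi> i) (\<mu> i))"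

definition wDr ::
  "'a::euclidean_space set \<Rightarrow> nat \<Rightarrow> nat \<Rightarrow> (nat \<Rightarrow> real) \<Rightarrow> real \<Rightarrow> (nat \<Rightarrow> 'a measure) \<Rightarrow> ereal" where
  "wDr \<Omega> M N w p \<mu> = (SUP \<phi>\<in>dual_admissible \<Omega> M N w p \<mu>. dual_value \<Omega> M N \<mu> \<phi>)"

definition wDr_maximizer ::
  "'a::euclidean_space set \<Rightarrow> nat \<Rightarrow> nat \<Rightarrow> (nat \<Rightarrow> real) \<Rightarrow> real \<Rightarrow> (nat \<Rightarrow> 'a measure)
    \<Rightarrow> (nat \<Rightarrow> 'a \<Rightarrow> ereal) \<Rightarrow> bool" where
  "wDr_maximizer \<Omega> M N w p \<mu> \<phi> \<longleftrightarrow>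
     \<phi> \<in> dual_admissible \<Omega> M N w p \<mu> \<and> dual_value \<Omega> M N \<mu> \<phi> = wDr \<Omega> M N w p \<mu>"

end

theory Submission
  imports Defs
begin

text \<open>Write \<open>D = (\<Sum>i. \<integral>\<phi>\<^sub>i d\<mu>\<^sub>i)\<close>, \<open>E = (\<Sum>i. \<integral>\<phi>\<^sub>i d\<eta>\<^sub>i)\<close> and
  \<open>I = \<integral>c d\<gamma>\<close>, where \<open>\<eta>\<^sub>i\<close> is the \<open>i\<close>-th marginal of the plan \<open>\<gamma>\<close> and \<open>c\<close> the infimal convolution
  cost. The convex order constraints give \<open>\<integral>\<phi>\<^sub>i d\<mu>\<^sub>i \<le> \<integral>\<phi>\<^sub>i d\<eta>\<^sub>i\<close> for every \<open>i\<close>, because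
  \<open>\<phi>\<^sub>i\<close> is convex exactly where \<open>\<eta>\<^sub>i\<close> dominates \<open>\<mu>\<^sub>i\<close> and concave where it is dominated; hence
  \<open>D \<le> E\<close>. The constraint \<open>\<Sum>i. \<phi>\<^sub>i(x\<^sub>i) \<le> c(x)\<close> gives \<open>E \<le> I\<close>. So \<open>D = I\<close> holds if and only if
  all these inequalities are equalities, which is what the optimality conditions on the right-hand side
  of the equivalence express (lemma \<open>complementary_slackness\<close>). On the other hand, if the primal
  and the dual value coincide, \<open>D = I\<close> says precisely that \<open>\<gamma>\<close> and \<open>\<phi>\<close> are both optimal. What remains is that there is no
  duality gap (lemma \<open>duality\<close>).

  The inequality \<open>D \<le> E\<close> is not immediate, since the convex order is tested only with real-valued
  convex functions on the whole space, whereas \<open>-\<phi>\<^sub>i\<close> may be \<open>\<infinity>\<close> and lives on \<open>K\<^sub>i\<close>. The Lipschitz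
  regularisations \<open>f\<^sub>n(x) = inf {f(y) + n |x - y| | y \<in> K}\<close> of a convex lower semicontinuous
  \<open>f\<close> on a compact \<open>K\<close>, finite at some point, are convex, finite everywhere and increase to \<open>f\<close> on \<open>K\<close>, so monotone convergence transfers the
  order to \<open>f\<close> and also yields the integrability of \<open>\<phi>\<^sub>i\<close> under \<open>\<eta>\<^sub>i\<close>
  (lemmas \<open>cx_le_nn_integral_lsc\<close> and \<open>cx_le_ereal_integral\<close>).

  For the absence of a gap let \<open>V\<close> exceed the dual value. Test the convex order with finitely many
  convex functions only and relax each test by \<open>\<delta> > 0\<close>. A theorem of the alternative
  (lemma \<open>finite_support_alternative\<close>) then offers two cases: there is a finitely supported
  probability on \<open>\<Omega>\<^sup>N\<close> that passes the relaxed tests with cost at most \<open>V\<close>, or there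
  are multipliers. The multipliers combine the test functions to admissible potentials of value at
  least \<open>V\<close>, which is impossible (lemma \<open>approximate_plan\<close>). Now let the tests run through a
  countable family of convex functions that is uniformly dense on \<open>\<Omega>\<close> and let \<open>\<delta>\<close> tend to \<open>0\<close>. A weak
  limit of the measures is a plan of cost at most \<open>V\<close> (lemma \<open>strong_duality\<close>). To obtain
  the limit from Helly's selection theorem on the line, all measures are
  carried by \<open>[0,1]\<close> by means of a Schoenberg space-filling curve onto \<open>\<Omega>\<^sup>N\<close>
  (lemma \<open>compact_convex_curve\<close>).\<close>

section \<open>Convex order on extended real-valued lower semicontinuous functions\<close>

text \<open>The Pasch--Hausdorff envelope, for \<open>L \<ge> 0\<close>: the largest \<open>L\<close>-Lipschitz function below \<open>g\<close>
  on \<open>S\<close>. It is defined on the whole space even if \<open>g\<close> is only meaningful on \<open>S\<close>.\<close>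

definition lipschitz_reg :: "'a::metric_space set \<Rightarrow> ('a \<Rightarrow> real) \<Rightarrow> real \<Rightarrow> 'a \<Rightarrow> real" where
  "lipschitz_reg S g L x = (INF y\<in>S. g y + L * dist x y)"

context
  fixes S :: "'a::metric_space set" and g :: "'a \<Rightarrow> real" and B :: real
  assumes S: "S \<noteq> {}" and B: "\<And>y. y \<in> S \<Longrightarrow> B \<le> g y"
begin

lemma lipschitz_reg_bdd: "0 \<le> L \<Longrightarrow> bdd_below ((\<lambda>y. g y + L * dist x y) ` S)"
  using B by (intro bdd_belowI2[of _ B]) (auto intro: add_increasing2)

lemma lipschitz_reg_le: "0 \<le> L \<Longrightarrow> y \<in> S \<Longrightarrow> lipschitz_reg S g L x \<le> g y + L * dist x y"
  unfolding lipschitz_reg_def by (intro cINF_lower lipschitz_reg_bdd)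

lemma lipschitz_reg_greatest:
  "(\<And>y. y \<in> S \<Longrightarrow> m \<le> g y + L * dist x y) \<Longrightarrow> m \<le> lipschitz_reg S g L x"
  unfolding lipschitz_reg_def using S by (intro cINF_greatest)

lemma lipschitz_reg_ge_bound: "0 \<le> L \<Longrightarrow> B \<le> lipschitz_reg S g L x"
  by (intro lipschitz_reg_greatest add_increasing2 B) auto

lemma lipschitz_reg_mono:
  "0 \<le> L \<Longrightarrow> L \<le> L' \<Longrightarrow> lipschitz_reg S g L x \<le> lipschitz_reg S g L' x"
  using lipschitz_reg_le[of L _ x] mult_right_mono[of L L' "dist x _"]
  by (intro lipschitz_reg_greatest) (meson add_left_mono order_trans zero_le_dist)

end

text \<open>The function \<open>(x, y) \<mapsto> g y + L |x - y|\<close> is jointly convex, and a partial infimum of a jointly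
  convex function is convex; near-minimisers for the two end points are combined to a competitor
  for the point between them.\<close>

lemma convex_on_lipschitz_reg:
  fixes S :: "'a::real_normed_vector set"
  assumes g: "convex_on S g" and S: "S \<noteq> {}" and B: "\<And>y. y \<in> S \<Longrightarrow> B \<le> g y" and L: "0 \<le> L"
  shows "convex_on UNIV (lipschitz_reg S g L)"
proof (rule convex_onI)
  fix t :: real and x x' :: 'a assume t: "0 < t" "t < 1"
  let ?f = "lipschitz_reg S g L"
  show "?f ((1 - t) *\<^sub>R x + t *\<^sub>R x') \<le> (1 - t) * ?f x + t * ?f x'"
  proof (rule field_le_epsilon)
    fix e :: real assume "0 < e"
    then have "\<exists>y\<in>S. g y + L * dist z y < ?f z + e" for z
      using cINF_less_iff[of S "\<lambda>y. g y + L * dist z y" "?f z + e", OF S lipschitz_reg_bdd[OF S B L]]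
      by (simp add: lipschitz_reg_def)
    then obtain y y' where y: "y \<in> S" "g y + L * dist x y < ?f x + e"
      and y': "y' \<in> S" "g y' + L * dist x' y' < ?f x' + e" by metis
    have "(1 - t) *\<^sub>R y + t *\<^sub>R y' \<in> S"
      using convex_on_imp_convex[OF g] y y' t by (auto simp: convex_alt)
    then have "?f ((1 - t) *\<^sub>R x + t *\<^sub>R x')
        \<le> g ((1 - t) *\<^sub>R y + t *\<^sub>R y') + L * dist ((1 - t) *\<^sub>R x + t *\<^sub>R x') ((1 - t) *\<^sub>R y + t *\<^sub>R y')"
      by (intro lipschitz_reg_le[OF S B L])
    also have "g ((1 - t) *\<^sub>R y + t *\<^sub>R y') \<le> (1 - t) * g y + t * g y'"
      using convex_onD[OF g, of t y y'] y y' t by simp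
    finally have 1: "?f ((1 - t) *\<^sub>R x + t *\<^sub>R x')
        \<le> (1 - t) * g y + t * g y' + L * dist ((1 - t) *\<^sub>R x + t *\<^sub>R x') ((1 - t) *\<^sub>R y + t *\<^sub>R y')"
      by simp
    have "dist ((1 - t) *\<^sub>R x + t *\<^sub>R x') ((1 - t) *\<^sub>R y + t *\<^sub>R y')
        = norm ((1 - t) *\<^sub>R (x - y) + t *\<^sub>R (x' - y'))"
      by (simp add: dist_norm algebra_simps)
    also have "\<dots> \<le> (1 - t) * dist x y + t * dist x' y'"
      using t by (intro norm_triangle_le) (simp add: dist_norm)
    finally have "L * dist ((1 - t) *\<^sub>R x + t *\<^sub>R x') ((1 - t) *\<^sub>R y + t *\<^sub>R y')
        \<le> L * ((1 - t) * dist x y + t * dist x' y')"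
      by (rule mult_left_mono[OF _ L])
    with 1 have "?f ((1 - t) *\<^sub>R x + t *\<^sub>R x')
        \<le> (1 - t) * (g y + L * dist x y) + t * (g y' + L * dist x' y')"
      by (simp add: algebra_simps)
    also have "\<dots> \<le> (1 - t) * (?f x + e) + t * (?f x' + e)"
      using y y' t by (intro add_mono[OF mult_left_mono mult_left_mono]) auto
    finally show "?f ((1 - t) *\<^sub>R x + t *\<^sub>R x') \<le> (1 - t) * ?f x + t * ?f x' + e"
      by (simp add: algebra_simps)
  qed
qed simp

text \<open>The distance to \<open>K\<close> is the regularisation of the zero function on \<open>K\<close> with constant \<open>1\<close>.\<close>

lemma convex_on_infdist:
  fixes K :: "'a::real_normed_vector set"
  assumes "convex K" "K \<noteq> {}"
  shows "convex_on UNIV (\<lambda>x. infdist x K)"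
proof -
  have "(\<lambda>x. infdist x K) = lipschitz_reg K (\<lambda>_. 0) 1"
    using assms by (auto simp: lipschitz_reg_def infdist_def)
  then show ?thesis
    using convex_on_lipschitz_reg[of K "\<lambda>_. 0" 0 1] assms by (simp add: convex_on_def)
qed

lemma continuous_on_convex_UNIV:
  fixes f :: "'a::euclidean_space \<Rightarrow> real"
  shows "convex_on UNIV f \<Longrightarrow> continuous_on A f"
  by (rule continuous_on_subset[OF convex_on_continuous[OF open_UNIV]]) auto

lemma borel_probsD:
  assumes "\<nu> \<in> borel_probs \<Omega>"
  shows "prob_space \<nu>" "sets \<nu> = sets (restrict_space borel \<Omega>)" "space \<nu> = \<Omega>"
  using assms sets_eq_imp_space_eq[of \<nu> "restrict_space borel \<Omega>"]
  by (auto simp: borel_probs_def space_restrict_space)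

lemma borel_measurable_borel_probs:
  fixes f :: "'a::topological_space \<Rightarrow> 'b::topological_space"
  assumes "\<nu> \<in> borel_probs \<Omega>" "continuous_on \<Omega> f"
  shows "f \<in> borel_measurable \<nu>"
  using borel_measurable_continuous_on_restrict[OF assms(2)]
    measurable_cong_sets[OF borel_probsD(2)[OF assms(1)] refl] by blast

lemma integrable_borel_probs:
  fixes f :: "'a::topological_space \<Rightarrow> real"
  assumes \<nu>: "\<nu> \<in> borel_probs \<Omega>" and "compact \<Omega>" "continuous_on \<Omega> f"
  shows "integrable \<nu> f"
proof -
  interpret prob_space \<nu> by (rule borel_probsD(1)[OF \<nu>])
  obtain b where "\<And>x. x \<in> \<Omega> \<Longrightarrow> norm (f x) \<le> b"
    using compact_imp_bounded[OF compact_continuous_image[OF assms(3,2)]]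
    by (auto simp: bounded_iff)
  then show ?thesis
    using borel_probsD(3)[OF \<nu>] borel_measurable_borel_probs[OF \<nu> assms(3)]
    by (intro integrable_const_bound[where B=b]) auto
qed

lemma sets_borel_probs_compact:
  fixes K :: "'a::euclidean_space set"
  assumes "\<nu> \<in> borel_probs \<Omega>" "compact K" "K \<subseteq> \<Omega>"
  shows "K \<in> sets \<nu>"
  using assms by (auto simp: borel_probsD(2)[OF assms(1)] sets_restrict_space borel_compact)


lemma ereal_le_via_reals:
  fixes x y :: ereal
  assumes "\<And>c. ereal c < x \<Longrightarrow> ereal c \<le> y"
  shows "x \<le> y"
proof (rule ccontr)
  assume "\<not> x \<le> y"
  then obtain c where "y < ereal c" "ereal c < x"
    using ereal_dense2[of y x] by (auto simp: not_le)
  with assms show False by (simp add: leD)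
qed

text \<open>Minimisation over points at distance at least \<open>\<delta>\<close> from \<open>x\<close> costs at least \<open>B + n \<delta>\<close>, which is
  eventually large, and at smaller distances lower semicontinuity keeps \<open>f\<close> above any given level
  below \<open>f x\<close>.\<close>

lemma lipschitz_reg_SUP_lsc:
  fixes f :: "'a::metric_space \<Rightarrow> ereal"
  assumes B: "\<And>y. y \<in> K \<Longrightarrow> ereal B \<le> f y"
    and lsc: "\<And>c. c < f x \<Longrightarrow> \<exists>\<delta>>0. \<forall>y\<in>K. dist y x < \<delta> \<longrightarrow> c < f y"
    and x: "x \<in> K" and S: "S = {y\<in>K. f y < \<infinity>}" "S \<noteq> {}"
  shows "(SUP n. ereal (lipschitz_reg S (\<lambda>y. real_of_ereal (f y)) (real n) x)) = f x"
proof -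
  define g where "g y = real_of_ereal (f y)" for y
  have g: "ereal (g y) = f y" if "y \<in> S" for y
    using that B[of y] S by (cases "f y") (auto simp: g_def)
  have Bg: "B \<le> g y" if "y \<in> S" for y
    using g[OF that, symmetric] B[of y] that S by simp
  show ?thesis unfolding g_def[symmetric]
  proof (rule antisym)
    show "(SUP n. ereal (lipschitz_reg S g (real n) x)) \<le> f x"
    proof (rule SUP_least)
      fix n :: nat
      show "ereal (lipschitz_reg S g (real n) x) \<le> f x"
      proof (cases "x \<in> S")
        case True
        then show ?thesis
          using lipschitz_reg_le[where L="real n" and x=x and y=x and g=g, OF S(2) Bg] g[OF True, symmetric] by simp
      qed (use x S in auto)
    qed
    show "f x \<le> (SUP n. ereal (lipschitz_reg S g (real n) x))"
    proof (rule ereal_le_via_reals)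
      fix c :: real assume "ereal c < f x"
      then obtain \<delta> where \<delta>: "0 < \<delta>" "\<And>y. y \<in> K \<Longrightarrow> dist y x < \<delta> \<Longrightarrow> ereal c < f y"
        using lsc by blast
      obtain n :: nat where "(c - B) / \<delta> < n" using reals_Archimedean2 by blast
      then have n: "c - B \<le> real n * \<delta>" using \<delta>(1) by (simp add: field_simps)
      have "c \<le> lipschitz_reg S g (real n) x"
      proof (rule lipschitz_reg_greatest[OF S(2) Bg])
        fix y assume y: "y \<in> S"
        show "c \<le> g y + real n * dist x y"
        proof (cases "dist y x < \<delta>")
          case True
          then have "c < g y" using \<delta>(2)[of y] y S g[OF y, symmetric] by auto
          then show ?thesis by (intro add_increasing2) auto
        next
          case False
          then have "real n * \<delta> \<le> real n * dist x y"
            by (intro mult_left_mono) (auto simp: dist_commute)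
          then show ?thesis using n Bg[OF y] by linarith
        qed
      qed
      then show "ereal c \<le> (SUP n. ereal (lipschitz_reg S g (real n) x))"
        by (intro SUP_upper2[of n]) auto
    qed
  qed
qed

text \<open>Unless \<open>f\<close> is \<open>\<infinity>\<close> on all of \<open>K\<close>, both sides are limits, by monotone convergence, of the integrals of the Lipschitz
  regularisations of \<open>f\<close>, and these are legitimate test functions for the convex order. The shift by
  the lower bound \<open>B\<close> makes all functions nonnegative, so that no integrability is required.\<close>

lemma cx_le_nn_integral_lsc:
  fixes f :: "'a::euclidean_space \<Rightarrow> ereal"
  assumes \<Omega>: "compact \<Omega>" and \<eta>: "\<eta> \<in> borel_probs \<Omega>" and \<mu>: "\<mu> \<in> borel_probs \<Omega>"
    and cx: "cx_le \<eta> \<mu>"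
    and K: "compact K" "convex K" "K \<subseteq> \<Omega>" "AE x in \<eta>. x \<in> K" "AE x in \<mu>. x \<in> K"
    and B: "\<And>y. y \<in> K \<Longrightarrow> ereal B \<le> f y"
    and lsc: "\<And>x c. x \<in> K \<Longrightarrow> c < f x \<Longrightarrow> \<exists>\<delta>>0. \<forall>y\<in>K. dist y x < \<delta> \<longrightarrow> c < f y"
    and convex: "\<And>x y t. \<lbrakk>x \<in> K; y \<in> K; f x < \<infinity>; f y < \<infinity>; 0 < t; t < 1\<rbrakk> \<Longrightarrow>
      f ((1 - t) *\<^sub>R x + t *\<^sub>R y) \<le> ereal (1 - t) * f x + ereal t * f y"
  shows "(\<integral>\<^sup>+x\<in>K. e2ennreal (f x - B) \<partial>\<eta>) \<le> (\<integral>\<^sup>+x\<in>K. e2ennreal (f x - B) \<partial>\<mu>)"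
proof -
  interpret \<mu>: prob_space \<mu> by (rule borel_probsD(1)[OF \<mu>])
  define S where "S = {y\<in>K. f y < \<infinity>}"
  note K_sets = sets_borel_probs_compact[OF \<eta> K(1,3)] sets_borel_probs_compact[OF \<mu> K(1,3)]
  show ?thesis
  proof (cases "S = {}")
    case True
    then have "(\<integral>\<^sup>+x\<in>K. e2ennreal (f x - B) \<partial>\<mu>) = (\<integral>\<^sup>+x. \<top> * indicator K x \<partial>\<mu>)"
      by (intro nn_integral_cong) (auto simp: S_def indicator_def)
    also have "\<dots> = \<top>"
      using \<mu>.prob_eq_1[OF K_sets(2)] K(5)
      by (subst nn_integral_cmult_indicator[OF K_sets(2)]) (auto simp: \<mu>.emeasure_eq_measure)
    finally show ?thesis by simp
  next
    case False
    define g where "g y = real_of_ereal (f y)" for y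
    have g: "ereal (g y) = f y" if "y \<in> S" for y
      using that B[of y] by (cases "f y") (auto simp: g_def S_def)
    have Bg: "B \<le> g y" if "y \<in> S" for y
      using g[OF that, symmetric] B[of y] that by (simp add: S_def)
    have comb: "(1 - t) *\<^sub>R x + t *\<^sub>R y \<in> S \<and> g ((1 - t) *\<^sub>R x + t *\<^sub>R y) \<le> (1 - t) * g x + t * g y"
      if "x \<in> S" "y \<in> S" "0 < t" "t < 1" for x y t
    proof -
      have "(1 - t) *\<^sub>R x + t *\<^sub>R y \<in> K"
        using that K(2) by (auto simp: S_def convex_alt)
      moreover have le: "f ((1 - t) *\<^sub>R x + t *\<^sub>R y) \<le> ereal ((1 - t) * g x + t * g y)"
        using convex[of x y t] that g[OF that(1), symmetric] g[OF that(2), symmetric]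
        by (auto simp: S_def)
      ultimately have "(1 - t) *\<^sub>R x + t *\<^sub>R y \<in> S" unfolding S_def by (auto simp: less_top[symmetric] top_ereal_def)
      with le show ?thesis using g by (metis ereal_less_eq(3))
    qed
    have "convex S"
      unfolding convex_alt
    proof (intro ballI allI impI)
      fix x y t assume xy: "x \<in> S" "y \<in> S" and t: "0 \<le> t \<and> t \<le> (1::real)"
      show "(1 - t) *\<^sub>R x + t *\<^sub>R y \<in> S"
        using comb[OF xy, of t] xy t by (cases "t = 0"; cases "t = 1") auto
    qed
    then have cvx: "convex_on S g" using comb by (intro convex_onI) blast+
    define h where "h n = lipschitz_reg S g (real n)" for n
    have h_cvx: "convex_on UNIV (h n)" for n
      unfolding h_def by (rule convex_on_lipschitz_reg[OF cvx False Bg]) auto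
    have h_cont: "continuous_on A (h n)" for A n
      by (rule continuous_on_convex_UNIV[OF h_cvx])
    have h_B: "B \<le> h n x" for n x
      unfolding h_def by (rule lipschitz_reg_ge_bound[OF False Bg]) auto
    have h_mono: "h n x \<le> h m x" if "n \<le> m" for n m x
      unfolding h_def using that by (intro lipschitz_reg_mono[OF False Bg]) auto
    have h_SUP: "(SUP n. ereal (h n x)) = f x" if "x \<in> K" for x
      unfolding h_def g_def using that False
      by (intro lipschitz_reg_SUP_lsc[where K=K and B=B] B lsc) (auto simp: S_def)
    have SUP: "e2ennreal (f x - B) = (SUP n. ennreal (h n x - B))" if "x \<in> K" for x
    proof -
      have "(\<lambda>n. ereal (h n x)) \<longlonglongrightarrow> f x"
        unfolding h_SUP[OF that, symmetric] by (rule LIMSEQ_SUP) (auto intro!: incseq_SucI h_mono)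
      then have "(\<lambda>n. ereal (h n x) - ereal B) \<longlonglongrightarrow> f x - ereal B"
        by (intro tendsto_diff_ereal_general) auto
      then have "(\<lambda>n. e2ennreal (ereal (h n x) - ereal B)) \<longlonglongrightarrow> e2ennreal (f x - ereal B)"
        by (rule tendsto_e2ennrealI)
      then have "(\<lambda>n. ennreal (h n x - B)) \<longlonglongrightarrow> e2ennreal (f x - ereal B)"
        by (simp add: ennreal.rep_eq[symmetric] e2ennreal_ereal)
      moreover have "(\<lambda>n. ennreal (h n x - B)) \<longlonglongrightarrow> (SUP n. ennreal (h n x - B))"
        by (rule LIMSEQ_SUP) (auto intro!: incseq_SucI ennreal_leI h_mono)
      ultimately show ?thesis by (rule LIMSEQ_unique)
    qed
    have eq: "(\<integral>\<^sup>+x\<in>K. ennreal (h n x - B) \<partial>\<nu>) = ennreal (\<integral>x. h n x \<partial>\<nu> - B)"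
      if \<nu>: "\<nu> \<in> borel_probs \<Omega>" "AE x in \<nu>. x \<in> K" for \<nu> n
    proof -
      interpret prob_space \<nu> by (rule borel_probsD(1)[OF \<nu>(1)])
      have int: "integrable \<nu> (h n)"
        by (rule integrable_borel_probs[OF \<nu>(1) \<Omega> h_cont])
      have "(\<integral>\<^sup>+x\<in>K. ennreal (h n x - B) \<partial>\<nu>) = (\<integral>\<^sup>+x. ennreal (h n x - B) \<partial>\<nu>)"
        using \<nu>(2) by (intro nn_integral_cong_AE) auto
      also have "\<dots> = ennreal (\<integral>x. h n x - B \<partial>\<nu>)"
        using int h_B by (intro nn_integral_eq_integral) auto
      finally show ?thesis using int by (simp add: prob_space)
    qed
    have lim: "(\<integral>\<^sup>+x\<in>K. e2ennreal (f x - B) \<partial>\<nu>) = (SUP n. ennreal (\<integral>x. h n x \<partial>\<nu> - B))"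
      if \<nu>: "\<nu> \<in> borel_probs \<Omega>" "AE x in \<nu>. x \<in> K" for \<nu>
    proof -
      have [measurable]: "K \<in> sets \<nu>" "\<And>n. h n \<in> borel_measurable \<nu>"
        using sets_borel_probs_compact[OF \<nu>(1) K(1,3)] borel_measurable_borel_probs[OF \<nu>(1) h_cont]
        by auto
      have "(\<integral>\<^sup>+x\<in>K. e2ennreal (f x - B) \<partial>\<nu>) = (\<integral>\<^sup>+x. (SUP n. ennreal (h n x - B) * indicator K x) \<partial>\<nu>)"
        by (intro nn_integral_cong) (auto simp: SUP indicator_def)
      also have "\<dots> = (SUP n. \<integral>\<^sup>+x\<in>K. ennreal (h n x - B) \<partial>\<nu>)"
        by (intro nn_integral_monotone_convergence_SUP)
           (auto intro!: incseq_SucI le_funI ennreal_leI h_mono simp: indicator_def)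
      finally show ?thesis by (simp add: eq[OF \<nu>])
    qed
    show ?thesis
      unfolding lim[OF \<eta> K(4)] lim[OF \<mu> K(5)]
      using cx h_cvx by (intro SUP_mono' ennreal_leI) (auto simp: cx_le_def)
  qed
qed

section \<open>Supports, and integrals of extended real-valued functions\<close>

text \<open>By the Lindelof property the complement of the support is a countable union of null sets.\<close>

lemma AE_measure_supp:
  fixes \<nu> :: "'a::second_countable_topology measure"
  assumes \<nu>: "\<nu> \<in> borel_probs \<Omega>"
  shows "AE x in \<nu>. x \<in> measure_supp \<nu>"
proof -
  define F where "F = {U. open U \<and> emeasure \<nu> (U \<inter> \<Omega>) = 0}"
  obtain F' where F': "F' \<subseteq> F" "countable F'" "\<Union>F' = \<Union>F"
    using Lindelof[of F] by (auto simp: F_def)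
  have "AE x in \<nu>. \<forall>U\<in>F'. x \<notin> U"
  proof (rule AE_ball_countable'[OF _ F'(2)])
    fix U assume "U \<in> F'"
    then have "open U" "emeasure \<nu> (U \<inter> \<Omega>) = 0" using F'(1) by (auto simp: F_def)
    moreover from this have "U \<inter> \<Omega> \<in> sets \<nu>"
      by (auto simp: borel_probsD(2)[OF \<nu>] sets_restrict_space)
    ultimately have "U \<inter> \<Omega> \<in> null_sets \<nu>" by auto
    then show "AE x in \<nu>. x \<notin> U"
      by (rule AE_I') (auto simp: borel_probsD(3)[OF \<nu>])
  qed
  with AE_space[of \<nu>] show ?thesis
  proof eventually_elim
    fix x assume x: "x \<in> space \<nu>" "\<forall>U\<in>F'. x \<notin> U"
    then have "x \<notin> \<Union>F" using F'(3) by blast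
    with x show "x \<in> measure_supp \<nu>"
      by (auto simp: measure_supp_def F_def borel_probsD(3)[OF \<nu>] zero_less_iff_neq_zero)
  qed
qed

lemma compact_measure_supp:
  assumes \<nu>: "\<nu> \<in> borel_probs \<Omega>" and "compact \<Omega>"
  shows "compact (measure_supp \<nu>)"
proof -
  have "measure_supp \<nu> = \<Omega> - \<Union>{U. open U \<and> emeasure \<nu> (U \<inter> \<Omega>) = 0}"
    by (auto simp: measure_supp_def borel_probsD(3)[OF \<nu>] zero_less_iff_neq_zero)
  also have "compact \<dots>"
    using assms(2) by (intro compact_diff open_Union) auto
  finally show ?thesis .
qed

lemma borel_probs_AE_nonempty:
  assumes "\<nu> \<in> borel_probs \<Omega>" "AE x in \<nu>. x \<in> K"
  shows "K \<noteq> {}"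
proof
  assume "K = {}"
  then have "AE x in \<nu>. False" using assms(2) by simp
  then show False using prob_space.AE_False[OF borel_probsD(1)[OF assms(1)]] by simp
qed

text \<open>The distance to \<open>K\<close> is a convex test function with integral \<open>0\<close> under the larger measure.\<close>

lemma cx_le_AE_mem:
  fixes K :: "'a::euclidean_space set"
  assumes \<Omega>: "compact \<Omega>" and \<eta>: "\<eta> \<in> borel_probs \<Omega>" and \<mu>: "\<mu> \<in> borel_probs \<Omega>"
    and cx: "cx_le \<eta> \<mu>"
    and K: "closed K" "convex K" "AE x in \<mu>. x \<in> K"
  shows "AE x in \<eta>. x \<in> K"
proof -
  have ne: "K \<noteq> {}" by (rule borel_probs_AE_nonempty[OF \<mu> K(3)])
  have int: "integrable \<eta> (\<lambda>x. infdist x K)"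
    by (intro integrable_borel_probs[OF \<eta> \<Omega>] continuous_intros)
  have "(\<integral>x. infdist x K \<partial>\<eta>) \<le> (\<integral>x. infdist x K \<partial>\<mu>)"
    using cx convex_on_infdist[OF K(2) ne] by (auto simp: cx_le_def)
  also have "\<dots> = (\<integral>x. 0 \<partial>\<mu>)"
    using K(3) by (intro integral_cong_AE borel_measurable_borel_probs[OF \<mu>] continuous_intros) auto
  finally have "(\<integral>x. infdist x K \<partial>\<eta>) = 0"
    by (simp add: antisym infdist_nonneg)
  then have "AE x in \<eta>. infdist x K = 0"
    using integral_nonneg_eq_0_iff_AE[OF int] by (simp add: infdist_nonneg)
  then show ?thesis
    by eventually_elim (use in_closed_iff_infdist_zero[OF K(1) ne] in blast)
qed

definition real_part_on :: "'a set \<Rightarrow> ('a \<Rightarrow> ereal) \<Rightarrow> 'a \<Rightarrow> real" where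
  "real_part_on A f x = indicator A x * real_of_ereal (f x)"

text \<open>These facts reduce the integrals of extended real-valued potentials to Bochner integrals.\<close>

lemma ereal_L1_onD:
  assumes A: "A \<in> sets \<nu>" and f: "ereal_L1_on A f \<nu>"
  shows "integrable \<nu> (real_part_on A f)"
    and "ereal_integral_on A f \<nu> = ereal (\<integral>x. real_part_on A f x \<partial>\<nu>)"
    and "AE x in \<nu>. x \<in> A \<longrightarrow> f x = ereal (real_part_on A f x)"
proof -
  define F where "F x = f x * indicator A x" for x
  let ?r = "real_part_on A f"
  have F[measurable]: "F \<in> borel_measurable \<nu>"
    using f borel_measurable_restrict_space_iff_ereal[of A \<nu> f] A
    by (simp add: ereal_L1_on_def F_def[abs_def])
  have r: "?r = (\<lambda>x. real_of_ereal (F x))"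
    by (auto simp: real_part_on_def F_def indicator_def)
  have [measurable]: "?r \<in> borel_measurable \<nu>" unfolding r by measurable
  have fin: "(\<integral>\<^sup>+x. e2ennreal \<bar>F x\<bar> \<partial>\<nu>) < \<infinity>"
  proof -
    have "(\<integral>\<^sup>+x. e2ennreal \<bar>F x\<bar> \<partial>\<nu>) = (\<integral>\<^sup>+x\<in>A. e2ennreal \<bar>f x\<bar> \<partial>\<nu>)"
      by (intro nn_integral_cong) (auto simp: F_def indicator_def)
    then show ?thesis using f by (simp add: ereal_L1_on_def)
  qed
  then have "AE x in \<nu>. e2ennreal \<bar>F x\<bar> \<noteq> \<infinity>"
    by (intro nn_integral_noteq_infinite) auto
  then have AE: "AE x in \<nu>. F x = ereal (?r x)"
  proof eventually_elim
    fix x assume "e2ennreal \<bar>F x\<bar> \<noteq> \<infinity>"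
    then show "F x = ereal (?r x)" unfolding r by (cases "F x") auto
  qed
  then show "AE x in \<nu>. x \<in> A \<longrightarrow> f x = ereal (?r x)"
    by eventually_elim (auto simp: F_def)
  have "(\<integral>\<^sup>+x. ennreal (norm (?r x)) \<partial>\<nu>) = (\<integral>\<^sup>+x. e2ennreal \<bar>F x\<bar> \<partial>\<nu>)"
    by (intro nn_integral_cong_AE eventually_mono[OF AE]) simp
  with fin show int: "integrable \<nu> ?r" by (intro integrableI_bounded) auto
  have ind: "e2ennreal (f x) * indicator A x = e2ennreal (F x)"
    "e2ennreal (- f x) * indicator A x = e2ennreal (- F x)" for x
    by (auto simp: F_def indicator_def)
  have P: "(\<integral>\<^sup>+x\<in>A. e2ennreal (f x) \<partial>\<nu>) = (\<integral>\<^sup>+x. ennreal (?r x) \<partial>\<nu>)"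
    by (intro nn_integral_cong_AE eventually_mono[OF AE]) (simp add: ind)
  have N: "(\<integral>\<^sup>+x\<in>A. e2ennreal (- f x) \<partial>\<nu>) = (\<integral>\<^sup>+x. ennreal (- ?r x) \<partial>\<nu>)"
    by (intro nn_integral_cong_AE eventually_mono[OF AE]) (simp add: ind)
  have "enn2ereal a - enn2ereal b = ereal (enn2real a - enn2real b)" if "a \<noteq> \<infinity>" "b \<noteq> \<infinity>" for a b
    using that by (cases a; cases b) (auto simp: enn2ereal_ennreal)
  moreover have "(\<integral>\<^sup>+x. ennreal (?r x) \<partial>\<nu>) \<noteq> \<infinity>" "(\<integral>\<^sup>+x. ennreal (- ?r x) \<partial>\<nu>) \<noteq> \<infinity>"
    using int by (auto simp: real_integrable_def)
  ultimately show "ereal_integral_on A f \<nu> = ereal (\<integral>x. ?r x \<partial>\<nu>)"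
    unfolding ereal_integral_on_def P N real_lebesgue_integral_def[OF int] by simp
qed

lemma ereal_L1_on_uminus:
  assumes "ereal_L1_on A f \<nu>"
  shows "ereal_L1_on A (\<lambda>x. - f x) \<nu>"
  using assms by (auto simp: ereal_L1_on_def)

lemma real_part_on_uminus: "real_part_on A (\<lambda>x. - f x) x = - real_part_on A f x"
  by (simp add: real_part_on_def)

lemma ereal_L1_on_continuous:
  fixes K :: "'a::euclidean_space set"
  assumes \<nu>: "\<nu> \<in> borel_probs \<Omega>" and K: "compact K" "K \<subseteq> \<Omega>"
    and g: "continuous_on K g" "\<And>x. x \<in> K \<Longrightarrow> f x = ereal (g x)"
  shows "ereal_L1_on K f \<nu>"
proof -
  interpret prob_space \<nu> by (rule borel_probsD(1)[OF \<nu>])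
  obtain b where b: "\<And>x. x \<in> K \<Longrightarrow> \<bar>g x\<bar> \<le> b"
    using compact_imp_bounded[OF compact_continuous_image[OF g(1) K(1)]]
    by (auto simp: bounded_iff)
  have "sets (restrict_space \<nu> K) = sets (restrict_space borel K)"
    using K(2) by (simp add: sets_restrict_space borel_probsD(2)[OF \<nu>] image_image
        Int_assoc[symmetric] Int_absorb2)
  then have "(\<lambda>x. ereal (g x)) \<in> borel_measurable (restrict_space \<nu> K)"
    using borel_measurable_continuous_on_restrict[OF g(1)]
    by (subst measurable_cong_sets[OF _ refl]) auto
  then have "f \<in> borel_measurable (restrict_space \<nu> K)"
    by (rule measurable_cong[THEN iffD1, rotated]) (auto simp: space_restrict_space g(2))
  moreover have "(\<integral>\<^sup>+x\<in>K. e2ennreal \<bar>f x\<bar> \<partial>\<nu>) \<le> (\<integral>\<^sup>+x. ennreal b \<partial>\<nu>)"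
    using b g(2) by (intro nn_integral_mono) (auto simp: indicator_def intro!: ennreal_leI)
  then have "(\<integral>\<^sup>+x\<in>K. e2ennreal \<bar>f x\<bar> \<partial>\<nu>) < \<infinity>"
    by (rule order.strict_trans1) (simp add: emeasure_space_1)
  ultimately show ?thesis by (simp add: ereal_L1_on_def)
qed

text \<open>The compactness argument behind the existence of minima: finitely many neighbourhoods, on each
  of which \<open>f\<close> exceeds a real constant, cover \<open>K\<close>.\<close>

lemma lsc_compact_bounded_below:
  fixes f :: "'a::metric_space \<Rightarrow> ereal"
  assumes "compact K" and fin: "\<And>x. x \<in> K \<Longrightarrow> f x \<noteq> -\<infinity>"
    and lsc: "\<And>x c. x \<in> K \<Longrightarrow> c < f x \<Longrightarrow> \<exists>\<delta>>0. \<forall>y\<in>K. dist y x < \<delta> \<longrightarrow> c < f y"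
  obtains B where "\<And>y. y \<in> K \<Longrightarrow> ereal B \<le> f y"
proof -
  have "\<exists>c \<delta>. 0 < \<delta> \<and> (\<forall>y\<in>K. dist y x < \<delta> \<longrightarrow> ereal c < f y)" if x: "x \<in> K" for x
  proof -
    obtain c where "ereal c < f x"
      using fin[OF x] by (metis ereal_dense2 less_ereal.simps(5) MInfty_neq_PInfty(1) ereal_less_eq(2) order_le_less)
    with lsc[OF x this] show ?thesis by blast
  qed
  then obtain c \<delta> where c: "\<And>x. x \<in> K \<Longrightarrow> 0 < \<delta> x"
    "\<And>x y. \<lbrakk>x \<in> K; y \<in> K; dist y x < \<delta> x\<rbrakk> \<Longrightarrow> ereal (c x) < f y" by metis
  obtain D where D: "D \<subseteq> K" "finite D" "K \<subseteq> (\<Union>x\<in>D. ball x (\<delta> x))"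
    using c(1) by (rule_tac compactE_image[OF assms(1), of K "\<lambda>x. ball x (\<delta> x)"]) auto
  show ?thesis
  proof (rule that[of "Min (insert 0 (c ` D))"])
    fix y assume "y \<in> K"
    then obtain x where x: "x \<in> D" "dist y x < \<delta> x" using D(3) by (auto simp: dist_commute)
    have "Min (insert 0 (c ` D)) \<le> c x" using x(1) D(2) by (intro Min_le) auto
    moreover have "ereal (c x) < f y" using c(2) x D(1) \<open>y \<in> K\<close> by blast
    ultimately show "ereal (Min (insert 0 (c ` D))) \<le> f y"
      by (meson ereal_less_eq(3) less_imp_le order_trans)
  qed
qed

lemma nn_integral_shift_ereal_L1_on:
  assumes "prob_space \<nu>" and A: "A \<in> sets \<nu>" "AE x in \<nu>. x \<in> A"
    and f: "ereal_L1_on A f \<nu>" and B: "\<And>x. x \<in> A \<Longrightarrow> ereal B \<le> f x"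
  shows "(\<integral>\<^sup>+x\<in>A. e2ennreal (f x - B) \<partial>\<nu>) = ennreal ((\<integral>x. real_part_on A f x \<partial>\<nu>) - B)"
    and "B \<le> (\<integral>x. real_part_on A f x \<partial>\<nu>)"
proof -
  interpret prob_space \<nu> by fact
  note r = ereal_L1_onD[OF A(1) f]
  have AE: "AE x in \<nu>. x \<in> A \<and> f x = ereal (real_part_on A f x) \<and> B \<le> real_part_on A f x"
    using r(3) A(2)
  proof eventually_elim
    fix x assume "x \<in> A \<longrightarrow> f x = ereal (real_part_on A f x)" "x \<in> A"
    then show "x \<in> A \<and> f x = ereal (real_part_on A f x) \<and> B \<le> real_part_on A f x"
      using B[of x] by simp
  qed
  have "(\<integral>\<^sup>+x\<in>A. e2ennreal (f x - B) \<partial>\<nu>) = (\<integral>\<^sup>+x. ennreal (real_part_on A f x - B) \<partial>\<nu>)"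
    by (intro nn_integral_cong_AE eventually_mono[OF AE]) simp
  also have "\<dots> = ennreal (\<integral>x. real_part_on A f x - B \<partial>\<nu>)"
    using r(1) AE by (intro nn_integral_eq_integral) auto
  finally show "(\<integral>\<^sup>+x\<in>A. e2ennreal (f x - B) \<partial>\<nu>) = ennreal ((\<integral>x. real_part_on A f x \<partial>\<nu>) - B)"
    using r(1) by (simp add: prob_space)
  have "(\<integral>x. B \<partial>\<nu>) \<le> (\<integral>x. real_part_on A f x \<partial>\<nu>)"
    using r(1) AE by (intro integral_mono_AE) auto
  then show "B \<le> (\<integral>x. real_part_on A f x \<partial>\<nu>)" by (simp add: prob_space)
qed

text \<open>Integrability passes from the larger measure in the convex order to the smaller one: the
  positive part is controlled by the comparison of the shifted integrals and the negative part is
  bounded.\<close>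

lemma cx_le_ereal_integral:
  fixes f :: "'a::euclidean_space \<Rightarrow> ereal"
  assumes \<Omega>: "compact \<Omega>" and \<eta>: "\<eta> \<in> borel_probs \<Omega>" and \<mu>: "\<mu> \<in> borel_probs \<Omega>"
    and cx: "cx_le \<eta> \<mu>"
    and K: "compact K" "convex K" "K \<subseteq> \<Omega>" "AE x in \<mu>. x \<in> K"
    and fin: "\<And>x. x \<in> K \<Longrightarrow> f x \<noteq> -\<infinity>"
    and lsc: "\<And>x c. x \<in> K \<Longrightarrow> c < f x \<Longrightarrow> \<exists>\<delta>>0. \<forall>y\<in>K. dist y x < \<delta> \<longrightarrow> c < f y"
    and convex: "\<And>x y t. \<lbrakk>x \<in> K; y \<in> K; f x < \<infinity>; f y < \<infinity>; 0 < t; t < 1\<rbrakk> \<Longrightarrow>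
      f ((1 - t) *\<^sub>R x + t *\<^sub>R y) \<le> ereal (1 - t) * f x + ereal t * f y"
    and L1: "ereal_L1_on K f \<mu>"
  shows "ereal_L1_on K f \<eta>"
    and "(\<integral>x. real_part_on K f x \<partial>\<eta>) \<le> (\<integral>x. real_part_on K f x \<partial>\<mu>)"
proof -
  obtain B where B: "\<And>y. y \<in> K \<Longrightarrow> ereal B \<le> f y"
    using lsc_compact_bounded_below[OF K(1) fin lsc] by metis
  interpret \<eta>: prob_space \<eta> by (rule borel_probsD(1)[OF \<eta>])
  note K\<eta> = cx_le_AE_mem[OF \<Omega> \<eta> \<mu> cx compact_imp_closed[OF K(1)] K(2,4)]
  note K_sets = sets_borel_probs_compact[OF \<eta> K(1,3)] sets_borel_probs_compact[OF \<mu> K(1,3)]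
  have \<mu>_eq: "(\<integral>\<^sup>+x\<in>K. e2ennreal (f x - B) \<partial>\<mu>) = ennreal ((\<integral>x. real_part_on K f x \<partial>\<mu>) - B)"
    by (rule nn_integral_shift_ereal_L1_on(1)[OF borel_probsD(1)[OF \<mu>] K_sets(2) K(4) L1 B])
  have "(\<integral>\<^sup>+x\<in>K. e2ennreal (f x - B) \<partial>\<eta>) \<le> (\<integral>\<^sup>+x\<in>K. e2ennreal (f x - B) \<partial>\<mu>)"
    by (rule cx_le_nn_integral_lsc[OF \<Omega> \<eta> \<mu> cx K(1-3) K\<eta> K(4) B lsc convex])
  then have le: "(\<integral>\<^sup>+x\<in>K. e2ennreal (f x - B) \<partial>\<eta>) \<le> ennreal ((\<integral>x. real_part_on K f x \<partial>\<mu>) - B)"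
    using \<mu>_eq by (simp only:)
  have "sets (restrict_space \<eta> K) = sets (restrict_space \<mu> K)"
    by (intro sets_restrict_space_cong) (simp add: borel_probsD(2)[OF \<eta>] borel_probsD(2)[OF \<mu>])
  then have meas: "f \<in> borel_measurable (restrict_space \<eta> K)"
    using L1 measurable_cong_sets[OF _ refl, of "restrict_space \<eta> K" "restrict_space \<mu> K" "borel :: ereal measure"]
    by (simp add: ereal_L1_on_def)
  have m: "(\<lambda>x. f x * indicator K x) \<in> borel_measurable \<eta>"
    using meas borel_measurable_restrict_space_iff_ereal[of K \<eta> f] K_sets(1) by simp
  have "(\<integral>\<^sup>+x\<in>K. e2ennreal \<bar>f x\<bar> \<partial>\<eta>)
      \<le> (\<integral>\<^sup>+x. e2ennreal (f x * indicator K x - B * indicator K x) + ennreal \<bar>B\<bar> \<partial>\<eta>)"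
  proof (intro nn_integral_mono)
    fix x
    show "e2ennreal \<bar>f x\<bar> * indicator K x
        \<le> e2ennreal (f x * indicator K x - B * indicator K x) + ennreal \<bar>B\<bar>"
    proof (cases "x \<in> K")
      case True
      then show ?thesis
        using B[of x] by (cases "f x") (auto simp: ennreal_plus[symmetric] simp del: ennreal_plus intro!: ennreal_leI)
    qed simp
  qed
  also have "\<dots> = (\<integral>\<^sup>+x. e2ennreal (f x * indicator K x - B * indicator K x) \<partial>\<eta>) + ennreal \<bar>B\<bar>"
    using m K_sets(1) by (subst nn_integral_add) (auto simp: \<eta>.emeasure_space_1)
  also have "(\<integral>\<^sup>+x. e2ennreal (f x * indicator K x - B * indicator K x) \<partial>\<eta>)
      = (\<integral>\<^sup>+x\<in>K. e2ennreal (f x - B) \<partial>\<eta>)"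
    by (intro nn_integral_cong) (auto simp: indicator_def)
  also have "\<dots> + ennreal \<bar>B\<bar> < \<infinity>"
    using order.strict_trans1[OF le ennreal_less_top] by (simp add: less_top)
  finally show L1': "ereal_L1_on K f \<eta>"
    using meas by (simp add: ereal_L1_on_def)
  have "(\<integral>\<^sup>+x\<in>K. e2ennreal (f x - B) \<partial>\<eta>) = ennreal ((\<integral>x. real_part_on K f x \<partial>\<eta>) - B)"
    by (rule nn_integral_shift_ereal_L1_on(1)[OF borel_probsD(1)[OF \<eta>] K_sets(1) K\<eta> L1' B])
  moreover have "B \<le> (\<integral>x. real_part_on K f x \<partial>\<mu>)"
    by (rule nn_integral_shift_ereal_L1_on(2)[OF borel_probsD(1)[OF \<mu>] K_sets(2) K(4) L1 B])
  ultimately show "(\<integral>x. real_part_on K f x \<partial>\<eta>) \<le> (\<integral>x. real_part_on K f x \<partial>\<mu>)"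
    using le by (simp add: ennreal_le_iff)
qed

section \<open>The infimal convolution cost and its plans\<close>

locale barycentric_transport =
  fixes \<Omega> :: "'a::euclidean_space set" and M N :: nat and w :: "nat \<Rightarrow> real" and p :: real
    and \<mu> :: "nat \<Rightarrow> 'a measure"
  assumes compact_\<Omega>: "compact \<Omega>" and convex_\<Omega>: "convex \<Omega>"
    and M_le: "M \<le> N" and N_pos: "0 < N" and p_gt: "1 < p"
    and \<mu>: "\<And>i. i \<in> {1..N} \<Longrightarrow> \<mu> i \<in> borel_probs \<Omega>"
    and w: "\<And>i. i \<in> {1..N} \<Longrightarrow> w i \<in> {0<..<1}" and sum_w: "(\<Sum>i=1..N. w i) = 1"
begin

abbreviation "c \<equiv> cbar \<Omega> N w p"
abbreviation "K \<equiv> pot_dom \<Omega> M \<mu>"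

lemma \<Omega>_nonempty: "\<Omega> \<noteq> {}"
proof -
  have "\<mu> 1 \<in> borel_probs \<Omega>" using \<mu>[of 1] N_pos by simp
  then show ?thesis
    using prob_space.not_empty borel_probsD(1,3) by blast
qed

lemma cost_nonneg: "0 \<le> (\<Sum>i=1..N. w i * norm (x i - z) powr p)"
  using w by (intro sum_nonneg mult_nonneg_nonneg) (auto intro: less_imp_le)

lemma cbar_le: "z \<in> \<Omega> \<Longrightarrow> c x \<le> (\<Sum>i=1..N. w i * norm (x i - z) powr p)"
  unfolding cbar_def using cost_nonneg by (intro cINF_lower bdd_belowI2[of _ 0]) auto

lemma cbar_greatest:
  "(\<And>z. z \<in> \<Omega> \<Longrightarrow> m \<le> (\<Sum>i=1..N. w i * norm (x i - z) powr p)) \<Longrightarrow> m \<le> c x"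
  unfolding cbar_def using \<Omega>_nonempty by (intro cINF_greatest) auto

lemma cbar_cong: "(\<And>i. i \<in> {1..N} \<Longrightarrow> x i = y i) \<Longrightarrow> c x = c y"
  by (simp add: cbar_def)

text \<open>Uniform continuity of \<open>|x - z|\<^sup>p\<close> on \<open>\<Omega> \<times> \<Omega>\<close> gives a modulus that does not depend on \<open>z\<close>, so
  it survives the infimum; the weights sum up to \<open>1\<close>.\<close>

lemma cbar_uniform:
  assumes "0 < \<epsilon>"
  obtains \<delta> where "0 < \<delta>"
    "\<And>x y. (\<And>i. i \<in> {1..N} \<Longrightarrow> x i \<in> \<Omega> \<and> y i \<in> \<Omega> \<and> dist (x i) (y i) < \<delta>) \<Longrightarrow> c y \<le> c x + \<epsilon>"
proof -
  have "uniformly_continuous_on (\<Omega> \<times> \<Omega>) (\<lambda>(x, z). norm (x - z) powr p)"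
    using p_gt unfolding case_prod_unfold
    by (intro compact_uniformly_continuous compact_Times compact_\<Omega> continuous_on_powr' continuous_intros) auto
  then obtain \<delta> where \<delta>: "0 < \<delta>"
    "\<And>x y z. \<lbrakk>x \<in> \<Omega>; y \<in> \<Omega>; z \<in> \<Omega>; dist x y < \<delta>\<rbrakk> \<Longrightarrow> \<bar>norm (x - z) powr p - norm (y - z) powr p\<bar> < \<epsilon>"
  proof (rule uniformly_continuous_onE[OF _ assms])
    fix d assume d: "0 < d" "\<And>u v. \<lbrakk>u \<in> \<Omega> \<times> \<Omega>; v \<in> \<Omega> \<times> \<Omega>; dist v u < d\<rbrakk> \<Longrightarrow>
        dist ((\<lambda>(x, z). norm (x - z) powr p) v) ((\<lambda>(x, z). norm (x - z) powr p) u) < \<epsilon>"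
    show thesis
    proof (rule that[OF d(1)])
      fix x y z assume "x \<in> \<Omega>" "y \<in> \<Omega>" "z \<in> \<Omega>" "dist x y < d"
      then show "\<bar>norm (x - z) powr p - norm (y - z) powr p\<bar> < \<epsilon>"
        using d(2)[of "(y, z)" "(x, z)"] by (simp add: dist_Pair_Pair dist_real_def)
    qed
  qed
  show ?thesis
  proof (rule that[OF \<delta>(1)])
    fix x y assume xy: "\<And>i. i \<in> {1..N} \<Longrightarrow> x i \<in> \<Omega> \<and> y i \<in> \<Omega> \<and> dist (x i) (y i) < \<delta>"
    have "c y - \<epsilon> \<le> c x"
    proof (rule cbar_greatest)
      fix z assume z: "z \<in> \<Omega>"
      have "c y \<le> (\<Sum>i=1..N. w i * norm (y i - z) powr p)" by (rule cbar_le[OF z])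
      also have "\<dots> \<le> (\<Sum>i=1..N. w i * (norm (x i - z) powr p + \<epsilon>))"
      proof (intro sum_mono mult_left_mono)
        fix i assume i: "i \<in> {1..N}"
        show "norm (y i - z) powr p \<le> norm (x i - z) powr p + \<epsilon>"
          using \<delta>(2)[of "x i" "y i" z] xy[OF i] z by (simp add: abs_less_iff)
        show "0 \<le> w i" using w[OF i] by simp
      qed
      also have "\<dots> = (\<Sum>i=1..N. w i * norm (x i - z) powr p) + \<epsilon>"
        using sum_w by (simp add: distrib_left sum.distrib sum_distrib_right[symmetric])
      finally show "c y - \<epsilon> \<le> (\<Sum>i=1..N. w i * norm (x i - z) powr p)" by simp
    qed
    then show "c y \<le> c x + \<epsilon>" by simp
  qed
qed

lemma continuous_on_cbar:
  fixes T :: "'b::metric_space set"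
  assumes G: "\<And>i. i \<in> {1..N} \<Longrightarrow> continuous_on T (G i)" "\<And>i t. i \<in> {1..N} \<Longrightarrow> t \<in> T \<Longrightarrow> G i t \<in> \<Omega>"
  shows "continuous_on T (\<lambda>t. c (\<lambda>i. G i t))"
  unfolding continuous_on_iff
proof (intro ballI allI impI)
  fix t and e :: real assume t: "t \<in> T" and "0 < e"
  then obtain \<delta> where \<delta>: "0 < \<delta>"
    "\<And>x y. (\<And>i. i \<in> {1..N} \<Longrightarrow> x i \<in> \<Omega> \<and> y i \<in> \<Omega> \<and> dist (x i) (y i) < \<delta>) \<Longrightarrow> c y \<le> c x + e / 2"
    using cbar_uniform[of "e / 2"] by auto
  have "\<forall>\<^sub>F s in at t within T. \<forall>i\<in>{1..N}. dist (G i s) (G i t) < \<delta>"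
    using G(1) t \<delta>(1) by (intro eventually_ball_finite) (auto simp: continuous_on_def intro: tendstoD)
  then obtain d where d: "0 < d"
    "\<And>s. \<lbrakk>s \<in> T; s \<noteq> t; dist s t < d\<rbrakk> \<Longrightarrow> \<forall>i\<in>{1..N}. dist (G i s) (G i t) < \<delta>"
    unfolding eventually_at by blast
  show "\<exists>d>0. \<forall>s\<in>T. dist s t < d \<longrightarrow> dist (c (\<lambda>i. G i s)) (c (\<lambda>i. G i t)) < e"
  proof (intro exI[of _ d] conjI ballI impI d(1))
    fix s assume s: "s \<in> T" "dist s t < d"
    have *: "dist (G i s) (G i t) < \<delta>" if "i \<in> {1..N}" for i
      using d(2)[of s] s that \<delta>(1) by (cases "s = t") auto
    have "c (\<lambda>i. G i s) \<le> c (\<lambda>i. G i t) + e / 2" "c (\<lambda>i. G i t) \<le> c (\<lambda>i. G i s) + e / 2"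
      using * s t G(2) by (intro \<delta>(2); auto simp: dist_commute)+
    then show "dist (c (\<lambda>i. G i s)) (c (\<lambda>i. G i t)) < e"
      using \<open>0 < e\<close> by (simp add: dist_real_def)
  qed
qed

lemma cbar_bounded:
  obtains b where "\<And>x. (\<And>i. i \<in> {1..N} \<Longrightarrow> x i \<in> \<Omega>) \<Longrightarrow> norm (c x) \<le> b"
proof -
  obtain D where D: "\<And>x y. x \<in> \<Omega> \<Longrightarrow> y \<in> \<Omega> \<Longrightarrow> dist x y \<le> D"
    using compact_imp_bounded[OF compact_\<Omega>] by (metis bounded_two_points)
  obtain z where z: "z \<in> \<Omega>" using \<Omega>_nonempty by auto
  show ?thesis
  proof (rule that[of "D powr p"])
    fix x assume x: "\<And>i. i \<in> {1..N} \<Longrightarrow> x i \<in> \<Omega>"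
    have "c x \<le> (\<Sum>i=1..N. w i * norm (x i - z) powr p)" by (rule cbar_le[OF z])
    also have "\<dots> \<le> (\<Sum>i=1..N. w i * D powr p)"
      using w x D z p_gt by (intro sum_mono mult_left_mono powr_mono2) (auto simp: dist_norm less_imp_le)
    also have "\<dots> = D powr p" using sum_w by (simp add: sum_distrib_right[symmetric])
    finally show "norm (c x) \<le> D powr p" using cbar_greatest[OF cost_nonneg, of x] by simp
  qed
qed

lemma measurable_coordinate:
  "i \<in> {1..N} \<Longrightarrow> (\<lambda>x. x i) \<in> PiM {1..N} (\<lambda>_. restrict_space borel \<Omega>) \<rightarrow>\<^sub>M borel"
  by (rule measurable_compose[OF measurable_component_singleton])
     (auto intro: measurable_restrict_space1)

text \<open>The infimum over \<open>\<Omega>\<close> can be taken over a countable dense subset, as the integrand is continuous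
  in \<open>z\<close>.\<close>

lemma measurable_cbar: "c \<in> borel_measurable (PiM {1..N} (\<lambda>_. restrict_space borel \<Omega>))"
proof -
  obtain D where D: "countable D" "D \<subseteq> \<Omega>" "\<Omega> \<subseteq> closure D" by (rule separable)
  have "c = (\<lambda>x. INF z\<in>D. \<Sum>i=1..N. w i * norm (x i - z) powr p)"
  proof
    fix x :: "nat \<Rightarrow> 'a"
    define F where "F z = (\<Sum>i=1..N. w i * norm (x i - z) powr p)" for z
    have bdd: "bdd_below (F ` A)" for A
      unfolding F_def by (intro bdd_belowI2[of _ 0] cost_nonneg)
    have "D \<noteq> {}" using D \<Omega>_nonempty by auto
    have "c x = (INF z\<in>\<Omega>. F z)" by (simp add: cbar_def F_def)
    also have "\<dots> = (INF z\<in>D. F z)"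
    proof (rule antisym)
      show "(INF z\<in>\<Omega>. F z) \<le> (INF z\<in>D. F z)"
        using D \<open>D \<noteq> {}\<close> by (intro cINF_superset_mono bdd) auto
      have "closed {z. (INF z\<in>D. F z) \<le> F z}"
        unfolding F_def using p_gt
        by (intro closed_Collect_le continuous_intros continuous_on_powr') auto
      moreover have "D \<subseteq> {z. (INF z\<in>D. F z) \<le> F z}"
        by (auto intro: cINF_lower bdd)
      ultimately have "\<Omega> \<subseteq> {z. (INF z\<in>D. F z) \<le> F z}"
        using D(3) closure_minimal by blast
      then show "(INF z\<in>D. F z) \<le> (INF z\<in>\<Omega>. F z)"
        using \<Omega>_nonempty by (intro cINF_greatest) auto
    qed
    finally show "c x = (INF z\<in>D. \<Sum>i=1..N. w i * norm (x i - z) powr p)" by (simp add: F_def)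
  qed
  moreover note [measurable] = measurable_coordinate
  have "(\<lambda>x. INF z\<in>D. \<Sum>i=1..N. w i * norm (x i - z) powr p)
      \<in> borel_measurable (PiM {1..N} (\<lambda>_. restrict_space borel \<Omega>))"
    by (intro borel_measurable_cINF_real D(1) borel_measurable_sum) measurable
  ultimately show ?thesis by simp
qed

lemma plansD:
  assumes "\<gamma> \<in> plans \<Omega> M N \<mu>"
  shows "prob_space \<gamma>" "sets \<gamma> = sets (PiM {1..N} (\<lambda>_. restrict_space borel \<Omega>))"
    "space \<gamma> = (\<Pi>\<^sub>E i\<in>{1..N}. \<Omega>)"
    "i \<in> {1..M} \<Longrightarrow> cx_le (\<mu> i) (marginal \<Omega> i \<gamma>)"
    "i \<in> {M+1..N} \<Longrightarrow> cx_le (marginal \<Omega> i \<gamma>) (\<mu> i)"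
  using assms sets_eq_imp_space_eq[of \<gamma> "PiM {1..N} (\<lambda>_. restrict_space borel \<Omega>)"]
  by (auto simp: plans_def borel_probs_prod_def space_PiM space_restrict_space)

lemma measurable_plan_coordinate:
  assumes "\<gamma> \<in> borel_probs_prod \<Omega> N" "i \<in> {1..N}"
  shows "(\<lambda>x. x i) \<in> \<gamma> \<rightarrow>\<^sub>M restrict_space borel \<Omega>"
proof -
  have "sets \<gamma> = sets (PiM {1..N} (\<lambda>_. restrict_space borel \<Omega>))"
    using assms(1) by (simp add: borel_probs_prod_def)
  from measurable_cong_sets[OF this refl] show ?thesis
    using measurable_component_singleton[OF assms(2)] by blast
qed

lemma marginal_borel_probs:
  assumes "\<gamma> \<in> borel_probs_prod \<Omega> N" "i \<in> {1..N}"
  shows "marginal \<Omega> i \<gamma> \<in> borel_probs \<Omega>"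
  using prob_space.prob_space_distr[OF _ measurable_plan_coordinate[OF assms]] assms(1)
  by (auto simp: borel_probs_def marginal_def borel_probs_prod_def)

lemma integral_marginal:
  fixes f :: "'a \<Rightarrow> real"
  assumes "\<gamma> \<in> borel_probs_prod \<Omega> N" "i \<in> {1..N}" "f \<in> borel_measurable (marginal \<Omega> i \<gamma>)"
  shows "(\<integral>x. f x \<partial>marginal \<Omega> i \<gamma>) = (\<integral>x. f (x i) \<partial>\<gamma>)"
  using assms(3) unfolding marginal_def
  by (intro integral_distr measurable_plan_coordinate assms) simp

lemma integrable_cbar:
  assumes "\<gamma> \<in> plans \<Omega> M N \<mu>"
  shows "integrable \<gamma> c"
proof -
  interpret prob_space \<gamma> by (rule plansD[OF assms])
  obtain b where "\<And>x. (\<And>i. i \<in> {1..N} \<Longrightarrow> x i \<in> \<Omega>) \<Longrightarrow> norm (c x) \<le> b"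
    using cbar_bounded by metis
  then show ?thesis
    using measurable_cbar measurable_cong_sets[OF plansD(2)[OF assms] refl]
    by (intro integrable_const_bound[where B=b]) (auto simp: plansD(3)[OF assms] PiE_iff)
qed

section \<open>Weak duality and complementary slackness\<close>

lemma pot_dom:
  assumes i: "i \<in> {1..N}"
  shows "compact (K i)" "convex (K i)" "K i \<subseteq> \<Omega>" "AE x in \<mu> i. x \<in> K i"
proof -
  have sub: "measure_supp (\<mu> i) \<subseteq> \<Omega>"
    using borel_probsD(3)[OF \<mu>[OF i]] by (auto simp: measure_supp_def)
  show "compact (K i)"
    using compact_\<Omega> compact_measure_supp[OF \<mu>[OF i] compact_\<Omega>]
    by (simp add: pot_dom_def compact_convex_hull)
  show "convex (K i)" using convex_\<Omega> by (simp add: pot_dom_def)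
  show "K i \<subseteq> \<Omega>" using sub convex_\<Omega> by (simp add: pot_dom_def hull_minimal)
  show "AE x in \<mu> i. x \<in> K i"
    using AE_space[of "\<mu> i"] AE_measure_supp[OF \<mu>[OF i]]
  proof eventually_elim
    fix x assume "x \<in> space (\<mu> i)" "x \<in> measure_supp (\<mu> i)"
    then show "x \<in> K i"
      using borel_probsD(3)[OF \<mu>[OF i]] hull_inc by (auto simp: pot_dom_def)
  qed
qed

lemma dual_admissible_convex:
  assumes "\<phi> \<in> dual_admissible \<Omega> M N w p \<mu>" "i \<in> {1..M}"
  obtains f :: "'a \<Rightarrow> real"
  where "convex_on \<Omega> f" "continuous_on \<Omega> f" "\<And>x. x \<in> \<Omega> \<Longrightarrow> \<phi> i x = ereal (f x)"
proof -
  have "\<forall>i\<in>{1..M}. \<exists>f :: 'a \<Rightarrow> real. convex_on \<Omega> f \<and> continuous_on \<Omega> f \<and> (\<forall>x\<in>\<Omega>. \<phi> i x = ereal (f x))"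
    using assms(1) by (simp add: dual_admissible_def)
  from bspec[OF this assms(2)] show ?thesis using that by blast
qed

lemma dual_admissible_concave:
  assumes "\<phi> \<in> dual_admissible \<Omega> M N w p \<mu>" "i \<in> {M+1..N}"
  shows "\<And>x. x \<in> K i \<Longrightarrow> \<phi> i x \<noteq> \<infinity>" "ereal_concave_on (K i) (\<phi> i)"
    "ereal_usc_on (K i) (\<phi> i)" "ereal_L1_on (K i) (\<phi> i) (\<mu> i)"
proof -
  have "\<forall>i\<in>{M+1..N}. (\<forall>x\<in>K i. \<phi> i x \<noteq> \<infinity>) \<and> ereal_concave_on (K i) (\<phi> i) \<and>
      ereal_usc_on (K i) (\<phi> i) \<and> ereal_L1_on (K i) (\<phi> i) (\<mu> i)"
    using assms(1) by (simp add: dual_admissible_def)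
  from bspec[OF this assms(2)]
  show "\<And>x. x \<in> K i \<Longrightarrow> \<phi> i x \<noteq> \<infinity>" "ereal_concave_on (K i) (\<phi> i)"
    "ereal_usc_on (K i) (\<phi> i)" "ereal_L1_on (K i) (\<phi> i) (\<mu> i)"
    by auto
qed

text \<open>For \<open>i \<le> M\<close> the convex potential \<open>\<phi>\<^sub>i\<close> is integrated against \<open>\<mu>\<^sub>i \<le>\<^bsub>cx\<^esub> \<eta>\<^sub>i\<close>; for \<open>i > M\<close> the
  roles of the two measures are exchanged and the convex function is \<open>-\<phi>\<^sub>i\<close>, whence the same
  inequality for \<open>\<phi>\<^sub>i\<close>. Thus \<open>\<phi>\<^sub>i\<close> gains mass in both cases.\<close>

lemma potential_comparison:
  assumes \<phi>: "\<phi> \<in> dual_admissible \<Omega> M N w p \<mu>" and \<gamma>: "\<gamma> \<in> plans \<Omega> M N \<mu>" and i: "i \<in> {1..N}"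
  shows "ereal_L1_on (K i) (\<phi> i) (\<mu> i)" "ereal_L1_on (K i) (\<phi> i) (marginal \<Omega> i \<gamma>)"
    and "AE x in marginal \<Omega> i \<gamma>. x \<in> K i"
    and "(\<integral>x. real_part_on (K i) (\<phi> i) x \<partial>\<mu> i) \<le> (\<integral>x. real_part_on (K i) (\<phi> i) x \<partial>marginal \<Omega> i \<gamma>)"
proof -
  have \<eta>: "marginal \<Omega> i \<gamma> \<in> borel_probs \<Omega>"
    using \<gamma> by (intro marginal_borel_probs i) (simp add: plans_def)
  have "ereal_L1_on (K i) (\<phi> i) (\<mu> i) \<and> ereal_L1_on (K i) (\<phi> i) (marginal \<Omega> i \<gamma>) \<and>
      (AE x in marginal \<Omega> i \<gamma>. x \<in> K i) \<and>
      (\<integral>x. real_part_on (K i) (\<phi> i) x \<partial>\<mu> i) \<le> (\<integral>x. real_part_on (K i) (\<phi> i) x \<partial>marginal \<Omega> i \<gamma>)"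
  proof (cases "i \<le> M")
    case True
    then have iM: "i \<in> {1..M}" and K: "K i = \<Omega>" using i by (auto simp: pot_dom_def)
    obtain f where f: "convex_on \<Omega> f" "continuous_on \<Omega> f" "\<And>x. x \<in> \<Omega> \<Longrightarrow> \<phi> i x = ereal (f x)"
      using dual_admissible_convex[OF \<phi> iM] by metis
    have L1: "ereal_L1_on \<Omega> (\<phi> i) (marginal \<Omega> i \<gamma>)"
      by (rule ereal_L1_on_continuous[OF \<eta> compact_\<Omega> order_refl f(2,3)])
    have AE: "AE x in marginal \<Omega> i \<gamma>. x \<in> \<Omega>"
      using AE_space[of "marginal \<Omega> i \<gamma>"] unfolding borel_probsD(3)[OF \<eta>] .
    have lsc: "\<exists>\<delta>>0. \<forall>y\<in>\<Omega>. dist y x < \<delta> \<longrightarrow> a < \<phi> i y" if x: "x \<in> \<Omega>" "a < \<phi> i x" for x a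
    proof -
      have "((\<lambda>y. ereal (f y)) \<longlongrightarrow> ereal (f x)) (at x within \<Omega>)"
        using f(2) x by (intro tendsto_ereal) (auto simp: continuous_on_def)
      then have "\<forall>\<^sub>F y in at x within \<Omega>. a < ereal (f y)"
        using x f(3) by (intro order_tendstoD(1)) auto
      then obtain \<delta> where "0 < \<delta>" "\<forall>y\<in>\<Omega>. y \<noteq> x \<and> dist y x < \<delta> \<longrightarrow> a < ereal (f y)"
        unfolding eventually_at by blast
      then show ?thesis using f(3) x by (intro exI[of _ \<delta>]) auto
    qed
    have cvx: "\<phi> i ((1 - t) *\<^sub>R x + t *\<^sub>R y) \<le> ereal (1 - t) * \<phi> i x + ereal t * \<phi> i y"
      if "x \<in> \<Omega>" "y \<in> \<Omega>" "0 < t" "t < 1" for x y t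
    proof -
      have "(1 - t) *\<^sub>R x + t *\<^sub>R y \<in> \<Omega>"
        using that convex_\<Omega> by (auto simp: convex_alt)
      then show ?thesis using convex_onD[OF f(1), of t x y] that f(3) by simp
    qed
    note * = compact_\<Omega> \<mu>[OF i] \<eta> plansD(4)[OF \<gamma> iM] compact_\<Omega> convex_\<Omega> order_refl AE _ lsc cvx L1
    have "ereal_L1_on \<Omega> (\<phi> i) (\<mu> i)"
      by (rule cx_le_ereal_integral(1)[OF *]) (use f(3) in auto)
    moreover have "(\<integral>x. real_part_on \<Omega> (\<phi> i) x \<partial>\<mu> i) \<le> (\<integral>x. real_part_on \<Omega> (\<phi> i) x \<partial>marginal \<Omega> i \<gamma>)"
      by (rule cx_le_ereal_integral(2)[OF *]) (use f(3) in auto)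
    ultimately show ?thesis
      unfolding K using L1 AE by blast
  next
    case False
    then have iM: "i \<in> {M+1..N}" using i by auto
    note cx = plansD(5)[OF \<gamma> iM]
    note K = pot_dom[OF i]
    note ninf = dual_admissible_concave(1)[OF \<phi> iM] and conc = dual_admissible_concave(2)[OF \<phi> iM]
      and usc = dual_admissible_concave(3)[OF \<phi> iM] and L1 = dual_admissible_concave(4)[OF \<phi> iM]
    have AE: "AE x in marginal \<Omega> i \<gamma>. x \<in> K i"
      by (rule cx_le_AE_mem[OF compact_\<Omega> \<eta> \<mu>[OF i] cx compact_imp_closed[OF K(1)] K(2,4)])
    have lsc: "\<exists>\<delta>>0. \<forall>y\<in>K i. dist y x < \<delta> \<longrightarrow> a < - \<phi> i y" if x: "x \<in> K i" "a < - \<phi> i x" for x a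
    proof -
      have "\<phi> i x < - a" using x(2) by (metis ereal_less_uminus_reorder)
      then have "Limsup (at x within K i) (\<phi> i) < - a"
        using usc x(1) by (auto simp: ereal_usc_on_def intro: le_less_trans)
      then have "\<forall>\<^sub>F y in at x within K i. \<phi> i y < - a" by (rule Limsup_lessD)
      then obtain \<delta> where "0 < \<delta>" "\<forall>y\<in>K i. y \<noteq> x \<and> dist y x < \<delta> \<longrightarrow> \<phi> i y < - a"
        unfolding eventually_at by blast
      then show ?thesis
        using x(2) by (intro exI[of _ \<delta>]) (metis ereal_less_uminus_reorder)
    qed
    have cvx: "- \<phi> i ((1 - t) *\<^sub>R x + t *\<^sub>R y) \<le> ereal (1 - t) * - \<phi> i x + ereal t * - \<phi> i y"
      if "x \<in> K i" "y \<in> K i" "- \<phi> i x < \<infinity>" "- \<phi> i y < \<infinity>" "0 < t" "t < 1" for x y t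
    proof -
      have "ereal (1 - t) * \<phi> i x + ereal t * \<phi> i y \<le> \<phi> i ((1 - t) *\<^sub>R x + t *\<^sub>R y)"
        using conc that by (auto simp: ereal_concave_on_def)
      then show ?thesis
        using that ninf[of x] ninf[of y]
        by (cases "\<phi> i x"; cases "\<phi> i y"; cases "\<phi> i ((1 - t) *\<^sub>R x + t *\<^sub>R y)") auto
    qed
    note * = compact_\<Omega> \<eta> \<mu>[OF i] cx K _ lsc cvx ereal_L1_on_uminus[OF L1]
    have "ereal_L1_on (K i) (\<lambda>x. - \<phi> i x) (marginal \<Omega> i \<gamma>)"
      by (rule cx_le_ereal_integral(1)[OF *]) (use ninf in auto)
    from ereal_L1_on_uminus[OF this] have "ereal_L1_on (K i) (\<phi> i) (marginal \<Omega> i \<gamma>)" by simp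
    moreover have "(\<integral>x. real_part_on (K i) (\<lambda>x. - \<phi> i x) x \<partial>marginal \<Omega> i \<gamma>)
        \<le> (\<integral>x. real_part_on (K i) (\<lambda>x. - \<phi> i x) x \<partial>\<mu> i)"
      by (rule cx_le_ereal_integral(2)[OF *]) (use ninf in auto)
    ultimately show ?thesis
      using L1 AE by (simp add: real_part_on_uminus)
  qed
  then show "ereal_L1_on (K i) (\<phi> i) (\<mu> i)" "ereal_L1_on (K i) (\<phi> i) (marginal \<Omega> i \<gamma>)"
    "AE x in marginal \<Omega> i \<gamma>. x \<in> K i"
    "(\<integral>x. real_part_on (K i) (\<phi> i) x \<partial>\<mu> i) \<le> (\<integral>x. real_part_on (K i) (\<phi> i) x \<partial>marginal \<Omega> i \<gamma>)"
    by auto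
qed

lemma dual_value_real:
  assumes \<phi>: "\<phi> \<in> dual_admissible \<Omega> M N w p \<mu>" and \<gamma>: "\<gamma> \<in> plans \<Omega> M N \<mu>"
  shows "dual_value \<Omega> M N \<mu> \<phi> = ereal (\<Sum>i=1..N. \<integral>x. real_part_on (K i) (\<phi> i) x \<partial>\<mu> i)"
proof -
  have "ereal_integral_on (K i) (\<phi> i) (\<mu> i) = ereal (\<integral>x. real_part_on (K i) (\<phi> i) x \<partial>\<mu> i)"
    if i: "i \<in> {1..N}" for i
    using pot_dom(1,3)[OF i]
    by (intro ereal_L1_onD(2) potential_comparison(1)[OF \<phi> \<gamma> i] sets_borel_probs_compact[OF \<mu>[OF i]])
  then show ?thesis by (simp add: dual_value_def)
qed

lemma admissible_AE:
  assumes \<phi>: "\<phi> \<in> dual_admissible \<Omega> M N w p \<mu>" and \<gamma>: "\<gamma> \<in> plans \<Omega> M N \<mu>"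
  shows "AE x in \<gamma>. (\<forall>i\<in>{1..N}. x i \<in> K i) \<and>
      (\<Sum>i=1..N. \<phi> i (x i)) = ereal (\<Sum>i=1..N. real_part_on (K i) (\<phi> i) (x i)) \<and>
      (\<Sum>i=1..N. real_part_on (K i) (\<phi> i) (x i)) \<le> c x"
proof -
  have \<gamma>': "\<gamma> \<in> borel_probs_prod \<Omega> N" using \<gamma> by (simp add: plans_def)
  have "AE x in \<gamma>. \<forall>i\<in>{1..N}. x i \<in> K i \<and> \<phi> i (x i) = ereal (real_part_on (K i) (\<phi> i) (x i))"
  proof (intro AE_finite_allI)
    fix i assume i: "i \<in> {1..N}"
    have "K i \<in> sets (marginal \<Omega> i \<gamma>)"
      using pot_dom(1,3)[OF i] by (intro sets_borel_probs_compact[OF marginal_borel_probs[OF \<gamma>' i]])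
    from ereal_L1_onD(3)[OF this potential_comparison(2)[OF \<phi> \<gamma> i]] potential_comparison(3)[OF \<phi> \<gamma> i]
    have "AE y in marginal \<Omega> i \<gamma>. y \<in> K i \<and> \<phi> i y = ereal (real_part_on (K i) (\<phi> i) y)"
      by eventually_elim simp
    then show "AE x in \<gamma>. x i \<in> K i \<and> \<phi> i (x i) = ereal (real_part_on (K i) (\<phi> i) (x i))"
      unfolding marginal_def by (rule AE_distrD[OF measurable_plan_coordinate[OF \<gamma>' i]])
  qed simp
  with AE_space[of \<gamma>] show ?thesis
  proof eventually_elim
    fix x assume x: "x \<in> space \<gamma>"
      "\<forall>i\<in>{1..N}. x i \<in> K i \<and> \<phi> i (x i) = ereal (real_part_on (K i) (\<phi> i) (x i))"
    then have sum: "(\<Sum>i=1..N. \<phi> i (x i)) = ereal (\<Sum>i=1..N. real_part_on (K i) (\<phi> i) (x i))"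
      by simp
    have "\<forall>x \<in> (\<Pi>\<^sub>E i\<in>{1..N}. K i). (\<Sum>i=1..N. \<phi> i (x i)) \<le> ereal (c x)"
      using \<phi> by (simp add: dual_admissible_def)
    moreover have "x \<in> (\<Pi>\<^sub>E i\<in>{1..N}. K i)"
      using x by (auto simp: plansD(3)[OF \<gamma>] PiE_iff)
    ultimately have "(\<Sum>i=1..N. \<phi> i (x i)) \<le> ereal (c x)" by blast
    with x sum show "(\<forall>i\<in>{1..N}. x i \<in> K i) \<and>
      (\<Sum>i=1..N. \<phi> i (x i)) = ereal (\<Sum>i=1..N. real_part_on (K i) (\<phi> i) (x i)) \<and>
      (\<Sum>i=1..N. real_part_on (K i) (\<phi> i) (x i)) \<le> c x"
      by simp
  qed
qed

lemma integral_sum_potentials: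
  assumes \<phi>: "\<phi> \<in> dual_admissible \<Omega> M N w p \<mu>" and \<gamma>: "\<gamma> \<in> plans \<Omega> M N \<mu>"
  shows "integrable \<gamma> (\<lambda>x. \<Sum>i=1..N. real_part_on (K i) (\<phi> i) (x i))"
    and "(\<integral>x. (\<Sum>i=1..N. real_part_on (K i) (\<phi> i) (x i)) \<partial>\<gamma>)
      = (\<Sum>i=1..N. \<integral>x. real_part_on (K i) (\<phi> i) x \<partial>marginal \<Omega> i \<gamma>)"
proof -
  have \<gamma>': "\<gamma> \<in> borel_probs_prod \<Omega> N" using \<gamma> by (simp add: plans_def)
  have int: "integrable (marginal \<Omega> i \<gamma>) (real_part_on (K i) (\<phi> i))" if i: "i \<in> {1..N}" for i
    using pot_dom(1,3)[OF i]
    by (intro ereal_L1_onD(1) potential_comparison(2)[OF \<phi> \<gamma> i]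
          sets_borel_probs_compact[OF marginal_borel_probs[OF \<gamma>' i]])
  have int': "integrable \<gamma> (\<lambda>x. real_part_on (K i) (\<phi> i) (x i))" if i: "i \<in> {1..N}" for i
    using int[OF i] unfolding marginal_def
    by (rule integrable_distr[OF measurable_plan_coordinate[OF \<gamma>' i]])
  then show "integrable \<gamma> (\<lambda>x. \<Sum>i=1..N. real_part_on (K i) (\<phi> i) (x i))"
    by (intro Bochner_Integration.integrable_sum) simp
  have "(\<integral>x. real_part_on (K i) (\<phi> i) x \<partial>marginal \<Omega> i \<gamma>) = (\<integral>x. real_part_on (K i) (\<phi> i) (x i) \<partial>\<gamma>)"
    if i: "i \<in> {1..N}" for i
    using int[OF i] by (intro integral_marginal \<gamma>' i) auto
  then show "(\<integral>x. (\<Sum>i=1..N. real_part_on (K i) (\<phi> i) (x i)) \<partial>\<gamma>)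
      = (\<Sum>i=1..N. \<integral>x. real_part_on (K i) (\<phi> i) x \<partial>marginal \<Omega> i \<gamma>)"
    using int' by (subst Bochner_Integration.integral_sum) auto
qed

lemma sum_marginal_le_cost:
  assumes \<phi>: "\<phi> \<in> dual_admissible \<Omega> M N w p \<mu>" and \<gamma>: "\<gamma> \<in> plans \<Omega> M N \<mu>"
  shows "(\<Sum>i=1..N. \<integral>x. real_part_on (K i) (\<phi> i) x \<partial>marginal \<Omega> i \<gamma>) \<le> (\<integral>x. c x \<partial>\<gamma>)"
  unfolding integral_sum_potentials(2)[OF \<phi> \<gamma>, symmetric]
  using admissible_AE[OF \<phi> \<gamma>]
  by (intro integral_mono_AE integral_sum_potentials(1)[OF \<phi> \<gamma>] integrable_cbar[OF \<gamma>]) auto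

text \<open>The convex order bounds each integral against \<open>\<mu>\<^sub>i\<close> by the one against the marginal of \<open>\<gamma>\<close>, and
  the sum of the latter is at most the cost by the pointwise constraint.\<close>

lemma weak_duality:
  assumes \<phi>: "\<phi> \<in> dual_admissible \<Omega> M N w p \<mu>" and \<gamma>: "\<gamma> \<in> plans \<Omega> M N \<mu>"
  shows "dual_value \<Omega> M N \<mu> \<phi> \<le> ereal (\<integral>x. c x \<partial>\<gamma>)"
  unfolding dual_value_real[OF \<phi> \<gamma>]
  using order_trans[OF sum_mono[OF potential_comparison(4)[OF \<phi> \<gamma>]] sum_marginal_le_cost[OF \<phi> \<gamma>]]
  by simp

text \<open>In \<open>D \<le> E \<le> I\<close> both outer terms agree iff all inequalities are equalities: those between the
  individual integrals, and the pointwise bound of the sum of the potentials by the cost.\<close>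

lemma complementary_slackness:
  assumes \<phi>: "\<phi> \<in> dual_admissible \<Omega> M N w p \<mu>" and \<gamma>: "\<gamma> \<in> plans \<Omega> M N \<mu>"
  shows "dual_value \<Omega> M N \<mu> \<phi> = ereal (\<integral>x. c x \<partial>\<gamma>) \<longleftrightarrow>
    (AE x in \<gamma>. (\<forall>i\<in>{1..N}. x i \<in> K i) \<and> (\<Sum>i=1..N. \<phi> i (x i)) = ereal (c x)) \<and>
    (\<forall>i\<in>{1..N}. ereal_integral_on (K i) (\<phi> i) (marginal \<Omega> i \<gamma>) = ereal_integral_on (K i) (\<phi> i) (\<mu> i))"
proof -
  have \<gamma>': "\<gamma> \<in> borel_probs_prod \<Omega> N" using \<gamma> by (simp add: plans_def)
  define D where "D i = (\<integral>x. real_part_on (K i) (\<phi> i) x \<partial>\<mu> i)" for i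
  define E where "E i = (\<integral>x. real_part_on (K i) (\<phi> i) x \<partial>marginal \<Omega> i \<gamma>)" for i
  define S where "S x = (\<Sum>i=1..N. real_part_on (K i) (\<phi> i) (x i))" for x
  have DE: "D i \<le> E i" if "i \<in> {1..N}" for i
    unfolding D_def E_def by (rule potential_comparison(4)[OF \<phi> \<gamma> that])
  have "ereal_integral_on (K i) (\<phi> i) (\<mu> i) = ereal (D i)" if i: "i \<in> {1..N}" for i
    unfolding D_def using pot_dom(1,3)[OF i]
    by (intro ereal_L1_onD(2) potential_comparison(1)[OF \<phi> \<gamma> i] sets_borel_probs_compact[OF \<mu>[OF i]])
  moreover have "ereal_integral_on (K i) (\<phi> i) (marginal \<Omega> i \<gamma>) = ereal (E i)" if i: "i \<in> {1..N}" for i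
    unfolding E_def using pot_dom(1,3)[OF i]
    by (intro ereal_L1_onD(2) potential_comparison(2)[OF \<phi> \<gamma> i]
          sets_borel_probs_compact[OF marginal_borel_probs[OF \<gamma>' i]])
  ultimately have integrals: "(\<forall>i\<in>{1..N}. ereal_integral_on (K i) (\<phi> i) (marginal \<Omega> i \<gamma>) = ereal_integral_on (K i) (\<phi> i) (\<mu> i))
      \<longleftrightarrow> (\<forall>i\<in>{1..N}. E i = D i)"
    by simp
  have pot: "(AE x in \<gamma>. (\<forall>i\<in>{1..N}. x i \<in> K i) \<and> (\<Sum>i=1..N. \<phi> i (x i)) = ereal (c x)) \<longleftrightarrow> (AE x in \<gamma>. S x = c x)"
  proof (rule eventually_subst)
    show "AE x in \<gamma>. ((\<forall>i\<in>{1..N}. x i \<in> K i) \<and> (\<Sum>i=1..N. \<phi> i (x i)) = ereal (c x)) = (S x = c x)"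
      using admissible_AE[OF \<phi> \<gamma>] by eventually_elim (auto simp: S_def)
  qed
  have int: "integrable \<gamma> S" "integrable \<gamma> c" and ES: "(\<Sum>i=1..N. E i) = (\<integral>x. S x \<partial>\<gamma>)"
    unfolding S_def E_def integral_sum_potentials(2)[OF \<phi> \<gamma>]
    by (rule integral_sum_potentials(1)[OF \<phi> \<gamma>] integrable_cbar[OF \<gamma>] refl)+
  have S_le: "AE x in \<gamma>. S x \<le> c x"
    using admissible_AE[OF \<phi> \<gamma>] by eventually_elim (simp add: S_def)
  have AE_iff: "(\<integral>x. S x \<partial>\<gamma>) = (\<integral>x. c x \<partial>\<gamma>) \<longleftrightarrow> (AE x in \<gamma>. S x = c x)"
  proof
    assume "(\<integral>x. S x \<partial>\<gamma>) = (\<integral>x. c x \<partial>\<gamma>)"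
    then have "(\<integral>x. c x - S x \<partial>\<gamma>) = 0" using int by simp
    moreover have "AE x in \<gamma>. 0 \<le> c x - S x" using S_le by eventually_elim simp
    ultimately have "AE x in \<gamma>. c x - S x = 0"
      using int integral_nonneg_eq_0_iff_AE[of \<gamma> "\<lambda>x. c x - S x"] by simp
    then show "AE x in \<gamma>. S x = c x" by eventually_elim simp
  next
    assume "AE x in \<gamma>. S x = c x"
    then show "(\<integral>x. S x \<partial>\<gamma>) = (\<integral>x. c x \<partial>\<gamma>)" using int by (intro integral_cong_AE) auto
  qed
  have "(\<Sum>i=1..N. D i) = (\<integral>x. c x \<partial>\<gamma>) \<longleftrightarrow> (\<integral>x. S x \<partial>\<gamma>) = (\<integral>x. c x \<partial>\<gamma>) \<and> (\<forall>i\<in>{1..N}. E i = D i)"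
  proof
    assume eq: "(\<Sum>i=1..N. D i) = (\<integral>x. c x \<partial>\<gamma>)"
    have le: "(\<Sum>i=1..N. D i) \<le> (\<Sum>i=1..N. E i)" by (intro sum_mono DE)
    have "(\<integral>x. S x \<partial>\<gamma>) \<le> (\<integral>x. c x \<partial>\<gamma>)" by (intro integral_mono_AE int S_le)
    then have *: "(\<integral>x. S x \<partial>\<gamma>) = (\<integral>x. c x \<partial>\<gamma>)" "(\<Sum>i=1..N. D i) = (\<Sum>i=1..N. E i)"
      using le eq ES by auto
    then show "(\<integral>x. S x \<partial>\<gamma>) = (\<integral>x. c x \<partial>\<gamma>) \<and> (\<forall>i\<in>{1..N}. E i = D i)"
      using sum_mono_inv[OF *(2) DE] by auto
  next
    assume "(\<integral>x. S x \<partial>\<gamma>) = (\<integral>x. c x \<partial>\<gamma>) \<and> (\<forall>i\<in>{1..N}. E i = D i)"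
    then show "(\<Sum>i=1..N. D i) = (\<integral>x. c x \<partial>\<gamma>)" using ES by simp
  qed
  then show ?thesis
    unfolding pot integrals AE_iff[symmetric] dual_value_real[OF \<phi> \<gamma>] D_def[symmetric] by simp
qed

end

section \<open>A curve through all points of a power of a compact convex set\<close>

text \<open>A continuous function of period \<open>2\<close> that is constantly \<open>0\<close> on \<open>[0, 1/3]\<close> and \<open>1\<close> on
  \<open>[2/3, 1]\<close>, which makes it read off ternary digits from \<open>{0, 2}\<close>.\<close>

definition schoenberg_plateau :: "real \<Rightarrow> real" where
  "schoenberg_plateau s = max 0 (min 1 (1/2 - cos (pi * s)))"

lemma schoenberg_plateau_range: "schoenberg_plateau s \<in> {0..1}"
  by (auto simp: schoenberg_plateau_def)

lemma continuous_schoenberg_plateau: "continuous_on UNIV schoenberg_plateau"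
  unfolding schoenberg_plateau_def by (intro continuous_intros)

text \<open>Here \<open>d\<close> is the leading digit (halved) and \<open>r\<close> the remainder of an expansion with ternary digits
  in \<open>{0, 2}\<close>; the even part is removed by periodicity.\<close>

lemma schoenberg_plateau_digit:
  assumes d: "d \<in> {0, 1::int}" and r: "0 \<le> r" "r \<le> 1/3"
  shows "schoenberg_plateau (2 * real_of_int n + 2/3 * real_of_int d + r) = real_of_int d"
proof -
  define s where "s = 2/3 * real_of_int d + r"
  have per: "cos (pi * (2 * real_of_int n + s)) = cos (pi * s)"
  proof -
    have "pi * (2 * real_of_int n + s) = pi * s + real_of_int n * (2 * pi)"
      by (simp add: algebra_simps)
    then show ?thesis
      using cos.plus_of_int[of "pi * s" n] by (simp add: algebra_simps)
  qed
  show ?thesis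
  proof (cases "d = 0")
    case True
    have "pi * s \<le> pi / 3" "0 \<le> pi * s"
      using True r by (auto simp: s_def)
    then have "cos (pi * s) \<ge> cos (pi/3)"
      by (intro cos_monotone_0_pi_le) auto
    then show ?thesis
      using True per by (simp add: schoenberg_plateau_def s_def cos_60)
  next
    case False
    then have d1: "d = 1" using d by auto
    have "pi * s \<ge> pi * (2/3)" "pi * s \<le> pi * 1"
      by (intro mult_left_mono; use d1 r in \<open>simp add: s_def\<close>)+
    then have "cos (pi * s) \<le> cos (pi * (2/3))"
      by (intro cos_monotone_0_pi_le) auto
    moreover have "cos (pi * (2/3)) = - (1/2)"
      using cos_120 by (simp add: mult.commute)
    ultimately show ?thesis
      using d1 per by (simp add: schoenberg_plateau_def s_def add.assoc)
  qed
qed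

text \<open>Schoenberg's curve, in countably many coordinates: for \<open>t\<close> in the Cantor set, the \<open>k\<close>-th
  binary digit of the \<open>j\<close>-th coordinate is half the ternary digit of \<open>t\<close> at the place
  \<open>prod_encode (j, k)\<close>.\<close>

definition hilbert_curve :: "nat \<Rightarrow> real \<Rightarrow> real" where
  "hilbert_curve j t = (\<Sum>k. schoenberg_plateau (3 ^ prod_encode (j, k) * t) / 2 ^ Suc k)"

lemma continuous_hilbert_curve: "continuous_on UNIV (hilbert_curve j)"
proof -
  have "uniform_limit UNIV
      (\<lambda>n t. \<Sum>k<n. schoenberg_plateau (3 ^ prod_encode (j, k) * t) / 2 ^ Suc k)
      (hilbert_curve j) sequentially"
    unfolding hilbert_curve_def
  proof (rule Weierstrass_m_test)
    show "summable (\<lambda>k. 1 / 2 ^ Suc k :: real)"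
      using power_half_series by (simp add: power_divide sums_iff)
    show "norm (schoenberg_plateau (3 ^ prod_encode (j, k) * t) / 2 ^ Suc k) \<le> 1 / 2 ^ Suc k" for k t
      using schoenberg_plateau_range[of "3 ^ prod_encode (j, k) * t"] by (auto simp: divide_simps)
  qed
  then show ?thesis
    by (rule uniform_limit_theorem[rotated])
       (auto intro!: always_eventually continuous_intros
          continuous_on_compose2[OF continuous_schoenberg_plateau])
qed

text \<open>The partial sums are the truncations \<open>\<lfloor>2\<^sup>n a\<rfloor> / 2\<^sup>n\<close>. The value \<open>a = 1\<close> is left out because its
  truncations start with \<open>1\<close> and not with \<open>0\<close>.\<close>

lemma binary_expansion:
  fixes a :: real
  assumes "a \<in> {0..<1}"
  obtains d :: "nat \<Rightarrow> int" where "\<And>k. d k \<in> {0, 1::int}" "(\<lambda>k. d k / 2 ^ Suc k) sums a"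
proof
  define d where "d k = \<lfloor>2 ^ Suc k * a\<rfloor> - 2 * \<lfloor>2 ^ k * a\<rfloor>" for k
  define S where "S n = \<lfloor>2 ^ n * a\<rfloor> / 2 ^ n" for n
  have "\<lfloor>2 * x\<rfloor> - 2 * \<lfloor>x\<rfloor> \<in> {0, 1::int}" for x :: real
    by (simp; linarith)
  from this[of "2 ^ _ * a"] show "d k \<in> {0, 1::int}" for k
    unfolding d_def power_Suc mult.assoc by blast
  have "S \<longlonglongrightarrow> a"
  proof (rule tendsto_sandwich)
    show "\<forall>\<^sub>F n in sequentially. a - (1/2) ^ n \<le> S n" 
      unfolding S_def
    proof (intro always_eventually allI)
      fix n :: nat
      have "2 ^ n * a - 1 \<le> \<lfloor>2 ^ n * a\<rfloor>" by linarith
      then have "(2 ^ n * a - 1) / 2 ^ n \<le> \<lfloor>2 ^ n * a\<rfloor> / 2 ^ n"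
        by (intro divide_right_mono) auto
      then show "a - (1/2) ^ n \<le> \<lfloor>2 ^ n * a\<rfloor> / 2 ^ n"
        by (simp add: diff_divide_distrib power_one_over)
    qed
    show "\<forall>\<^sub>F n in sequentially. S n \<le> a"
      unfolding S_def
      by (intro always_eventually allI) (simp add: field_simps)
    show "(\<lambda>n. a - (1/2) ^ n) \<longlonglongrightarrow> a"
      by (rule tendsto_eq_intros LIMSEQ_power_zero | simp)+
  qed simp
  then have "(\<lambda>n. S (Suc n) - S n) sums (a - S 0)"
    by (rule telescope_sums)
  moreover have "S 0 = 0"
    using assms by (simp add: S_def floor_eq_iff)
  moreover have "S (Suc n) - S n = d n / 2 ^ Suc n" for n
    by (simp add: S_def d_def field_simps)
  ultimately show "(\<lambda>k. d k / 2 ^ Suc k) sums a" by simp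
qed

text \<open>Multiplication by \<open>3\<^sup>m\<close> turns the digits before the \<open>m\<close>-th one into an even integer, and the
  digits after it contribute at most \<open>1/3\<close>.\<close>

lemma cantor_point_plateau:
  fixes d :: "nat \<Rightarrow> int"
  assumes d: "\<And>m. d m \<in> {0, 1::int}"
  defines "t \<equiv> \<Sum>m. 2 * d m / 3 ^ Suc m"
  shows "t \<in> {0..1}" "schoenberg_plateau (3 ^ m * t) = d m"
proof -
  have geom: "(\<lambda>m. 2 / 3 ^ Suc m :: real) sums 1"
    using sums_mult[OF geometric_sums[of "1/3::real"], of "2/3"]
    by (simp add: power_divide field_simps)
  have le: "0 \<le> 2 * d m / 3 ^ Suc m" "2 * d m / 3 ^ Suc m \<le> (2 / 3 ^ Suc m :: real)" for m
    using d[of m] by auto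
  have sm: "summable (\<lambda>m. 2 * d m / 3 ^ Suc m :: real)"
    by (rule summable_comparison_test'[OF sums_summable[OF geom], of 0])
       (use le in \<open>simp only: real_norm_def abs_of_nonneg\<close>)
  have tail: "0 \<le> (\<Sum>k. 2 * d (k + n) / 3 ^ Suc (k + n) :: real)"
    "(\<Sum>k. 2 * d (k + n) / 3 ^ Suc (k + n) :: real) \<le> 1 / 3 ^ n" for n
  proof -
    have sm': "summable (\<lambda>k. 2 * d (k + n) / 3 ^ Suc (k + n) :: real)"
      using sm by (subst summable_iff_shift)
    show "0 \<le> (\<Sum>k. 2 * d (k + n) / 3 ^ Suc (k + n) :: real)"
      using le by (intro suminf_nonneg[OF sm']) blast
    have g: "(\<lambda>k. 2 / 3 ^ Suc (k + n) :: real) sums (1 / 3 ^ n)"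
      using sums_divide[OF geom, of "3 ^ n"] by (simp add: power_add field_simps)
    show "(\<Sum>k. 2 * d (k + n) / 3 ^ Suc (k + n) :: real) \<le> 1 / 3 ^ n"
      using suminf_le[OF _ sm' sums_summable[OF g]] le sums_unique[OF g] by simp
  qed
  from tail[of 0] show "t \<in> {0..1}" by (simp add: t_def)
  define r where "r = 3 ^ m * (\<Sum>k. 2 * d (k + Suc m) / 3 ^ Suc (k + Suc m) :: real)"
  have r: "0 \<le> r" "r \<le> 1/3"
    using tail[of "Suc m"] by (auto simp: r_def field_simps)
  define n where "n = (\<Sum>l<m. d l * 3 ^ (m - Suc l))"
  have "3 ^ m * (\<Sum>l<m. 2 * d l / 3 ^ Suc l :: real) = 2 * n"
  proof -
    have "3 ^ m * (2 * d l / 3 ^ Suc l :: real) = 2 * (d l * 3 ^ (m - Suc l))" if "l < m" for l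
    proof -
      have "m = (m - Suc l) + Suc l" using that by simp
      then have "(3::real) ^ m = 3 ^ (m - Suc l) * 3 ^ Suc l" by (metis power_add)
      then show ?thesis by simp
    qed
    then show ?thesis
      unfolding n_def by (simp add: sum_distrib_left)
  qed
  then have "3 ^ m * t = 2 * n + 2/3 * d m + r"
    unfolding t_def r_def suminf_split_initial_segment[OF sm, of "Suc m"]
    by (simp add: algebra_simps)
  then show "schoenberg_plateau (3 ^ m * t) = d m"
    using schoenberg_plateau_digit[OF d r] by simp
qed

text \<open>All binary digits of all coordinates are prescribed at once as the digits of a point of the
  Cantor set.\<close>

lemma hilbert_curve_surj:
  assumes "\<And>j. a j \<in> {0..<1}"
  obtains t where "t \<in> {0..1}" "\<And>j. hilbert_curve j t = a j"
proof -
  have "\<exists>d::nat \<Rightarrow> int. (\<forall>k. d k \<in> {0, 1::int}) \<and> (\<lambda>k. d k / 2 ^ Suc k) sums a j" for j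
    by (rule binary_expansion[OF assms[of j]]) (intro exI conjI allI)
  then have "\<exists>e. \<forall>j. (\<forall>k. e j k \<in> {0, 1::int}) \<and> (\<lambda>k. e j k / 2 ^ Suc k) sums a j"
    by (intro choice allI)
  then obtain e :: "nat \<Rightarrow> nat \<Rightarrow> int"
    where e: "\<forall>j. (\<forall>k. e j k \<in> {0, 1::int}) \<and> (\<lambda>k. e j k / 2 ^ Suc k) sums a j"
    by (elim exE)
  define d where "d m = case_prod e (prod_decode m)" for m
  have d: "d m \<in> {0, 1::int}" for m
    using e by (cases "prod_decode m") (simp add: d_def)
  define t where "t = (\<Sum>m. 2 * d m / 3 ^ Suc m :: real)"
  show ?thesis
  proof
    show "t \<in> {0..1}" unfolding t_def by (rule cantor_point_plateau(1)[of d, OF d])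
    have "schoenberg_plateau (3 ^ prod_encode (j, k) * t) = e j k" for j k
      unfolding t_def cantor_point_plateau(2)[of d, OF d] by (simp add: d_def)
    then show "hilbert_curve j t = a j" for j
      using e by (simp add: hilbert_curve_def sums_iff)
  qed
qed

text \<open>The curves \<open>G i\<close> jointly reach every sequence of points of \<open>K\<close>. Each point is
  described by its Euclidean coordinates; the nearest-point projection, which is continuous for
  convex \<open>K\<close> and fixes \<open>K\<close>, brings the curve back into \<open>K\<close>.\<close>

lemma compact_convex_curve:
  fixes K :: "'a::euclidean_space set"
  assumes "compact K" "convex K" "K \<noteq> {}"
  obtains G :: "nat \<Rightarrow> real \<Rightarrow> 'a" where
    "\<And>i. continuous_on UNIV (G i)" "\<And>i t. G i t \<in> K"
    "\<And>x. \<forall>i. x i \<in> K \<Longrightarrow> \<exists>t\<in>{0..1}. \<forall>i. G i t = x i"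
proof -
  \<comment> \<open>The strict bound keeps the rescaled coordinates below \<open>1\<close>, as the curve requires.\<close>
  obtain R where R: "0 < R" "\<And>x. x \<in> K \<Longrightarrow> norm x < R"
    using compact_imp_bounded[OF assms(1)] bounded_pos_less by metis
  define \<iota> where "\<iota> = (to_nat_on (Basis :: 'a set))"
  have \<iota>: "inj_on \<iota> Basis"
    unfolding \<iota>_def by (intro inj_on_to_nat_on countable_finite finite_Basis)
  define H :: "nat \<Rightarrow> real \<Rightarrow> 'a" where "H i t = (\<Sum>b\<in>Basis. (2 * R * hilbert_curve (prod_encode (i, \<iota> b)) t - R) *\<^sub>R b)" for i t
  show ?thesis
  proof
    show "continuous_on UNIV (\<lambda>t. closest_point K (H i t))" for i
      unfolding H_def using assms
      by (intro continuous_on_compose2[OF continuous_on_closest_point[where t=UNIV]] continuous_intros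
            continuous_on_compose2[OF continuous_hilbert_curve]) (auto intro: compact_imp_closed)
    show "closest_point K (H i t) \<in> K" for i t
      using assms by (intro closest_point_in_set) (auto intro: compact_imp_closed)
    fix x :: "nat \<Rightarrow> 'a" assume x: "\<forall>i. x i \<in> K"
    define a where "a j = (case prod_decode j of (i, n) \<Rightarrow>
        if n \<in> \<iota> ` Basis then (x i \<bullet> inv_into Basis \<iota> n + R) / (2 * R) else 0)" for j
    have "a j \<in> {0..<1}" for j
    proof -
      have "(x i \<bullet> b + R) / (2 * R) \<in> {0..<1}" if "b \<in> Basis" for i b
        using Basis_le_norm[OF that, of "x i"] R(1) R(2)[OF x[rule_format, of i]] by (auto simp: field_simps)
      then show ?thesis
        unfolding a_def by (auto split: prod.split simp: inv_into_into \<iota>)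
    qed
    then obtain t where t: "t \<in> {0..1}" "\<And>j. hilbert_curve j t = a j"
      using hilbert_curve_surj[of a] by blast
    have "H i t = (\<Sum>b\<in>Basis. (x i \<bullet> b) *\<^sub>R b)" for i
      unfolding H_def t(2) a_def using R(1)
      by (intro sum.cong refl) (auto simp: \<iota> field_simps)
    then have "H i t = x i" for i
      by (simp add: euclidean_representation)
    then show "\<exists>t\<in>{0..1}. \<forall>i. closest_point K (H i t) = x i"
      using t(1) x by (auto simp: closest_point_self intro!: bexI[of _ t])
  qed
qed

section \<open>A theorem of the alternative for finitely many functions\<close>

text \<open>A substitute for convexity of \<open>C\<close> and affinity of the functions \<open>a k\<close> that does not presuppose a
  vector space structure on \<open>C\<close>. The family of probability measures is of this kind.\<close>

definition affinely_convexlike :: "'c set \<Rightarrow> ('k \<Rightarrow> 'c \<Rightarrow> real) \<Rightarrow> 'k set \<Rightarrow> bool" where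
  "affinely_convexlike C a I \<longleftrightarrow>
     (\<forall>u\<in>C. \<forall>v\<in>C. \<forall>\<theta>\<in>{0..1}. \<exists>m\<in>C. \<forall>k\<in>I. a k m = (1 - \<theta>) * a k u + \<theta> * a k v)"

text \<open>The image of \<open>C\<close> under \<open>(a, b)\<close> is a convex subset of the plane that misses the open negative
  quadrant; a separating line has a normal vector with nonnegative entries.\<close>

lemma two_function_alternative:
  fixes a b :: "'c \<Rightarrow> real"
  assumes mix: "\<And>u v \<theta>. \<lbrakk>u \<in> C; v \<in> C; \<theta> \<in> {0..1}\<rbrakk> \<Longrightarrow>
      \<exists>m\<in>C. a m = (1 - \<theta>) * a u + \<theta> * a v \<and> b m = (1 - \<theta>) * b u + \<theta> * b v"
    and no_neg: "\<And>m. m \<in> C \<Longrightarrow> a m < 0 \<Longrightarrow> 0 \<le> b m"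
  obtains s t where "0 \<le> s" "0 \<le> t" "s + t = 1" "\<And>m. m \<in> C \<Longrightarrow> 0 \<le> s * a m + t * b m"
proof (cases "C = {}")
  case True
  then show ?thesis using that[of 0 1] by simp
next
  case False
  define S where "S = (\<lambda>m. (a m, b m)) ` C"
  define Q :: "(real \<times> real) set" where "Q = {..<0} \<times> {..<0}"
  have "convex S"
    unfolding convex_alt
  proof (intro ballI allI impI)
    fix x y \<theta> assume "x \<in> S" "y \<in> S" and \<theta>: "0 \<le> \<theta> \<and> \<theta> \<le> (1::real)"
    then obtain u v where uv: "u \<in> C" "v \<in> C" "x = (a u, b u)" "y = (a v, b v)"
      by (auto simp: S_def)
    with mix[of u v \<theta>] \<theta> obtain m where
      "m \<in> C" "a m = (1 - \<theta>) * a u + \<theta> * a v" "b m = (1 - \<theta>) * b u + \<theta> * b v" by auto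
    then show "(1 - \<theta>) *\<^sub>R x + \<theta> *\<^sub>R y \<in> S"
      using uv by (auto simp: S_def intro!: image_eqI[of _ _ m])
  qed
  moreover have "convex Q" unfolding Q_def by (intro convex_Times) (auto intro: convex_real_interval)
  moreover have "S \<noteq> {}" using False by (auto simp: S_def)
  moreover have "(-1, -1) \<in> Q" by (simp add: Q_def)
  moreover have "Q \<inter> S = {}"
    using no_neg by (force simp: S_def Q_def)
  ultimately obtain w c where w: "w \<noteq> 0" "\<And>x. x \<in> Q \<Longrightarrow> w \<bullet> x \<le> c" "\<And>x. x \<in> S \<Longrightarrow> c \<le> w \<bullet> x"
    using separating_hyperplane_sets[of Q S] by blast
  obtain s t where st: "w = (s, t)" by (cases w)
  have *: "s * x + t * y \<le> c" if "x < 0" "y < 0" for x y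
    using w(2)[of "(x, y)"] that by (simp add: Q_def st inner_prod_def)
  \<comment> \<open>The point \<open>(-e, -e)\<close> of the quadrant would contradict a negative separating level \<open>c\<close>.\<close>
  have c0: "0 \<le> c"
  proof (rule ccontr)
    assume "\<not> 0 \<le> c"
    define e where "e = - c / (2 * (\<bar>s\<bar> + \<bar>t\<bar> + 1))"
    have "0 < e" "- c = 2 * (\<bar>s\<bar> + \<bar>t\<bar> + 1) * e"
      using \<open>\<not> 0 \<le> c\<close> by (auto simp: e_def intro!: divide_neg_pos)
    then have "- c = 2 * (\<bar>s\<bar> * e) + 2 * (\<bar>t\<bar> * e) + 2 * e"
      by (simp add: algebra_simps)
    moreover have "s * (-e) + t * (-e) \<le> c" by (rule *) (use \<open>0 < e\<close> in auto)
    then have "- (s * e) - t * e \<le> c" by simp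
    moreover have "s * e \<le> \<bar>s\<bar> * e" "t * e \<le> \<bar>t\<bar> * e" "0 \<le> \<bar>s\<bar> * e" "0 \<le> \<bar>t\<bar> * e"
      using \<open>0 < e\<close> by (auto intro!: mult_right_mono)
    ultimately show False using \<open>0 < e\<close> by linarith
  qed
  \<comment> \<open>The quadrant is unbounded in each coordinate, so neither entry of the normal vector is negative.\<close>
  have s0: "0 \<le> s"
  proof (rule ccontr)
    assume "\<not> 0 \<le> s"
    then have "s * ((c + \<bar>t\<bar> + 1) / s) + t * (-1) \<le> c"
      using c0 by (intro *) (auto simp: field_simps)
    then have "c + \<bar>t\<bar> + 1 - t \<le> c" using \<open>\<not> 0 \<le> s\<close> by simp
    then show False by linarith
  qed
  have t0: "0 \<le> t"
  proof (rule ccontr)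
    assume "\<not> 0 \<le> t"
    then have "s * (-1) + t * ((c + \<bar>s\<bar> + 1) / t) \<le> c"
      using c0 by (intro *) (auto simp: field_simps)
    then show False using \<open>\<not> 0 \<le> t\<close> s0 by simp
  qed
  have pos: "0 < s + t" using w(1) s0 t0 st by (auto simp: zero_prod_def add_nonneg_eq_0_iff order.strict_iff_order)
  show ?thesis
  proof (rule that[of "s / (s + t)" "t / (s + t)"])
    fix m assume "m \<in> C"
    then have "c \<le> s * a m + t * b m"
      using w(3)[of "(a m, b m)"] by (auto simp: S_def st inner_prod_def)
    then show "0 \<le> s / (s + t) * a m + t / (s + t) * b m"
      using pos c0 by (simp add: divide_simps)
  qed (use pos s0 t0 in \<open>auto simp: add_divide_distrib[symmetric]\<close>)
qed

text \<open>If no point makes all functions negative at once, some convex combination of the functions is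
  nonnegative. Proceeding by induction needs separation in the plane only, so the number of
  functions may vary.\<close>

lemma finite_alternative:
  assumes "finite I" "I \<noteq> {}" "affinely_convexlike C a I"
    and "\<And>m. m \<in> C \<Longrightarrow> \<exists>k\<in>I. 0 \<le> a k m"
  shows "\<exists>\<beta>. (\<forall>k\<in>I. 0 \<le> \<beta> k) \<and> (\<Sum>k\<in>I. \<beta> k) = 1 \<and> (\<forall>m\<in>C. 0 \<le> (\<Sum>k\<in>I. \<beta> k * a k m))"
  using assms
proof (induction I arbitrary: C rule: finite_ne_induct)
  case (singleton k)
  then show ?case by (intro exI[of _ "\<lambda>_. 1"]) auto
next
  case (insert k I)
  \<comment> \<open>On the part of \<open>C\<close> where the new function is negative, the old functions satisfy the hypothesis;
    their combination and the new function are then treated by the case of two functions.\<close>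
  define C' where "C' = {m\<in>C. a k m < 0}"
  have "affinely_convexlike C' a I"
    unfolding affinely_convexlike_def
  proof (intro ballI)
    fix u v \<theta> assume uv: "u \<in> C'" "v \<in> C'" and \<theta>: "\<theta> \<in> {0..1::real}"
    then obtain m where m: "m \<in> C" "\<forall>j\<in>insert k I. a j m = (1 - \<theta>) * a j u + \<theta> * a j v"
      using insert.prems(1) unfolding affinely_convexlike_def C'_def by blast
    have "(1 - \<theta>) * a k u + \<theta> * a k v < 0"
    proof (cases "\<theta> = 0")
      case False
      then have "\<theta> * a k v < 0" "(1 - \<theta>) * a k u \<le> 0"
        using uv \<theta> by (auto simp: C'_def mult_le_0_iff mult_less_0_iff)
      then show ?thesis by simp
    qed (use uv in \<open>simp add: C'_def\<close>)
    with m show "\<exists>m\<in>C'. \<forall>j\<in>I. a j m = (1 - \<theta>) * a j u + \<theta> * a j v"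
      by (auto simp: C'_def)
  qed
  moreover have "\<exists>j\<in>I. 0 \<le> a j m" if "m \<in> C'" for m
    using insert.prems(2)[of m] that by (auto simp: C'_def)
  ultimately obtain \<beta> where \<beta>: "\<forall>j\<in>I. 0 \<le> \<beta> j" "(\<Sum>j\<in>I. \<beta> j) = 1"
    "\<And>m. m \<in> C' \<Longrightarrow> 0 \<le> (\<Sum>j\<in>I. \<beta> j * a j m)"
    using insert.IH by metis
  obtain s t where st: "0 \<le> s" "0 \<le> t" "s + t = 1"
    "\<And>m. m \<in> C \<Longrightarrow> 0 \<le> s * a k m + t * (\<Sum>j\<in>I. \<beta> j * a j m)"
  proof (rule two_function_alternative[of C "a k" "\<lambda>m. \<Sum>j\<in>I. \<beta> j * a j m"])
    fix u v \<theta> assume uv: "u \<in> C" "v \<in> C" and \<theta>: "\<theta> \<in> {0..1::real}"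
    then obtain m where m: "m \<in> C" "\<forall>j\<in>insert k I. a j m = (1 - \<theta>) * a j u + \<theta> * a j v"
      using insert.prems(1) unfolding affinely_convexlike_def by blast
    have "(\<Sum>j\<in>I. \<beta> j * a j m) = (\<Sum>j\<in>I. (1 - \<theta>) * (\<beta> j * a j u) + \<theta> * (\<beta> j * a j v))"
    proof (intro sum.cong refl)
      fix j assume "j \<in> I"
      with m(2) have "a j m = (1 - \<theta>) * a j u + \<theta> * a j v" by blast
      then show "\<beta> j * a j m = (1 - \<theta>) * (\<beta> j * a j u) + \<theta> * (\<beta> j * a j v)"
        by (simp only: distrib_left mult.left_commute)
    qed
    with m show "\<exists>m\<in>C. a k m = (1 - \<theta>) * a k u + \<theta> * a k v \<and>
        (\<Sum>j\<in>I. \<beta> j * a j m) = (1 - \<theta>) * (\<Sum>j\<in>I. \<beta> j * a j u) + \<theta> * (\<Sum>j\<in>I. \<beta> j * a j v)"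
      by (intro bexI[of _ m]) (simp_all add: sum.distrib sum_distrib_left)
  qed (use \<beta>(3) in \<open>auto simp: C'_def\<close>)
  define \<beta>' where "\<beta>' j = (if j = k then s else t * \<beta> j)" for j
  have eq: "(\<Sum>j\<in>insert k I. \<beta>' j * f j) = s * f k + t * (\<Sum>j\<in>I. \<beta> j * f j)" for f :: "_ \<Rightarrow> real"
  proof -
    have "(\<Sum>j\<in>I. \<beta>' j * f j) = (\<Sum>j\<in>I. t * (\<beta> j * f j))"
      using insert.hyps by (intro sum.cong) (auto simp: \<beta>'_def)
    then show ?thesis
      using insert.hyps by (simp add: \<beta>'_def sum_distrib_left)
  qed
  show ?case
  proof (intro exI[of _ \<beta>'] conjI)
    show "\<forall>j\<in>insert k I. 0 \<le> \<beta>' j" using st \<beta> by (auto simp: \<beta>'_def)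
    show "(\<Sum>j\<in>insert k I. \<beta>' j) = 1" using eq[of "\<lambda>_. 1"] \<beta>(2) st by simp
    show "\<forall>m\<in>C. 0 \<le> (\<Sum>j\<in>insert k I. \<beta>' j * a j m)"
      using st(4) by (simp only: eq) blast
  qed
qed

section \<open>Separability and weak limits\<close>

text \<open>Step functions on finite nets with rational values approximate every continuous function and
  form a countable set; for each of them and each tolerance one function within the class is
  selected, if there is one.\<close>

lemma countable_uniformly_dense:
  fixes T :: "'a::metric_space set" and P :: "('a \<Rightarrow> real) \<Rightarrow> bool"
  assumes T: "compact T" and cont: "\<And>f. P f \<Longrightarrow> continuous_on T f" and f0: "P f0"
  obtains F :: "nat \<Rightarrow> 'a \<Rightarrow> real" where "\<And>n. P (F n)"
    "\<And>f e. P f \<Longrightarrow> 0 < e \<Longrightarrow> \<exists>n. \<forall>x\<in>T. \<bar>F n x - f x\<bar> \<le> e"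
proof -
  have "\<exists>xs. set xs \<subseteq> T \<and> T \<subseteq> (\<Union>x\<in>set xs. ball x (inverse (Suc m)))" for m
  proof -
    obtain D where "D \<subseteq> T" "finite D" "T \<subseteq> (\<Union>x\<in>D. ball x (inverse (Suc m)))"
      by (rule compactE_image[OF T, of T "\<lambda>x. ball x (inverse (Suc m))"]) auto
    moreover from this(2) obtain xs where "set xs = D" using finite_list by blast
    ultimately show ?thesis by blast
  qed
  then obtain net where net: "\<And>m. set (net m) \<subseteq> T"
    "\<And>m. T \<subseteq> (\<Union>x\<in>set (net m). ball x (inverse (Suc m)))" by metis
  define near where "near m x = (LEAST j. j < length (net m) \<and> dist (net m ! j) x < inverse (Suc m))" for m x
  have near: "near m x < length (net m)" "dist (net m ! near m x) x < inverse (Suc m)"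
    if "x \<in> T" for m x
  proof -
    have "x \<in> (\<Union>y\<in>set (net m). ball y (inverse (Suc m)))" using net(2) that by blast
    then obtain y where "y \<in> set (net m)" "dist y x < inverse (Suc m)" by auto
    then obtain j where "j < length (net m) \<and> dist (net m ! j) x < inverse (Suc m)"
      by (auto simp: in_set_conv_nth)
    from LeastI[of "\<lambda>j. j < length (net m) \<and> dist (net m ! j) x < inverse (Suc m)", OF this]
    show "near m x < length (net m)" "dist (net m ! near m x) x < inverse (Suc m)"
      by (auto simp: near_def)
  qed
  define close where "close = (\<lambda>(m, qs :: rat list, k::nat) f.
      \<forall>x\<in>T. \<bar>f x - of_rat (qs ! near m x)\<bar> \<le> inverse (Suc k))"
  define F where "F n = (if \<exists>f. P f \<and> close (from_nat n) f then SOME f. P f \<and> close (from_nat n) f else f0)" for n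
  show ?thesis
  proof
    show "P (F n)" for n
    proof (cases "\<exists>f. P f \<and> close (from_nat n) f")
      case True
      then have "F n = (SOME f. P f \<and> close (from_nat n) f)" unfolding F_def by (rule if_P)
      then show ?thesis using someI_ex[OF True] by simp
    next
      case False
      then have "F n = f0" unfolding F_def by (rule if_not_P)
      then show ?thesis using f0 by simp
    qed
    fix f and e :: real assume f: "P f" and e: "0 < e"
    obtain k :: nat where "inverse (Suc k) < e / 2"
      using reals_Archimedean[of "e / 2"] e by auto
    define \<epsilon> where "\<epsilon> = inverse (real (Suc k))"
    have \<epsilon>: "0 < \<epsilon>" "2 * \<epsilon> < e" using \<open>inverse (Suc k) < e / 2\<close> by (auto simp: \<epsilon>_def)
    obtain \<delta> where \<delta>: "0 < \<delta>" "\<And>x y. \<lbrakk>x \<in> T; y \<in> T; dist x y < \<delta>\<rbrakk> \<Longrightarrow> dist (f x) (f y) < \<epsilon> / 2"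
    proof (rule uniformly_continuous_onE[OF compact_uniformly_continuous[OF cont[OF f] T]])
      show "0 < \<epsilon> / 2" using \<epsilon> by simp
    qed (use that in blast)
    obtain m :: nat where m: "inverse (Suc m) < \<delta>" using reals_Archimedean[OF \<delta>(1)] by auto
    have "\<exists>q. \<bar>of_rat q - y\<bar> < \<epsilon> / 2" for y :: real
    proof -
      obtain q where "y - \<epsilon>/2 < of_rat q" "of_rat q < y"
        using of_rat_dense[of "y - \<epsilon>/2" y] \<epsilon>(1) by auto
      then show ?thesis by (intro exI[of _ q]) auto
    qed
    then have "\<exists>q. \<forall>y::real. \<bar>of_rat (q y) - y\<bar> < \<epsilon> / 2" by (intro choice allI)
    then obtain q where q: "\<And>y::real. \<bar>of_rat (q y) - y\<bar> < \<epsilon> / 2" by blast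
    define code where "code = (m, map (q \<circ> f) (net m), k)"
    have "close code f"
      unfolding close_def code_def prod.case
    proof
      fix x assume x: "x \<in> T"
      let ?y = "net m ! near m x"
      have "?y \<in> T" using near(1)[OF x] net(1)[of m] by (meson nth_mem subsetD)
      then have "dist (f ?y) (f x) < \<epsilon> / 2"
        using \<delta>(2) x near(2)[OF x, of m] m by (meson less_trans)
      moreover have "\<bar>of_rat (q (f ?y)) - f ?y\<bar> < \<epsilon> / 2" by (rule q)
      ultimately have "\<bar>f x - of_rat (q (f ?y))\<bar> \<le> \<epsilon>"
        unfolding dist_real_def by linarith
      then show "\<bar>f x - of_rat (map (q \<circ> f) (net m) ! near m x)\<bar> \<le> inverse (Suc k)"
        using near(1)[OF x] by (simp add: \<epsilon>_def)
    qed
    define n where "n = to_nat code"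
    have ex: "\<exists>f. P f \<and> close (from_nat n) f" using \<open>close code f\<close> f by (auto simp: n_def)
    have "F n = (SOME f. P f \<and> close (from_nat n) f)" unfolding F_def by (rule if_P[OF ex])
    with someI_ex[OF ex] have "close code (F n)" by (simp add: n_def)
    with \<open>close code f\<close> have "\<bar>F n x - f x\<bar> \<le> 2 * \<epsilon>" if "x \<in> T" for x
      using that unfolding close_def code_def prod.case \<epsilon>_def[symmetric] by force
    then show "\<exists>n. \<forall>x\<in>T. \<bar>F n x - f x\<bar> \<le> e"
      using \<epsilon>(2) by (intro exI[of _ n] ballI) (meson less_imp_le order_trans)
  qed
qed

text \<open>The theorem of the alternative for the finitely supported probabilities on \<open>T\<close>, which are mixed
  by Bernoulli choices. Dirac measures turn the conclusion into a pointwise inequality.\<close>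

lemma finite_support_alternative:
  fixes h :: "'k \<Rightarrow> 't \<Rightarrow> real"
  assumes I: "finite I" "I \<noteq> {}"
  obtains p where "finite (set_pmf p)" "set_pmf p \<subseteq> T" "\<And>k. k \<in> I \<Longrightarrow> measure_pmf.expectation p (h k) < 0"
  | \<beta> where "\<And>k. k \<in> I \<Longrightarrow> 0 \<le> \<beta> k" "(\<Sum>k\<in>I. \<beta> k) = 1" "\<And>t. t \<in> T \<Longrightarrow> 0 \<le> (\<Sum>k\<in>I. \<beta> k * h k t)"
proof (cases "\<exists>p. finite (set_pmf p) \<and> set_pmf p \<subseteq> T \<and> (\<forall>k\<in>I. measure_pmf.expectation p (h k) < 0)")
  case True
  then obtain p where "finite (set_pmf p)" "set_pmf p \<subseteq> T" "\<forall>k\<in>I. measure_pmf.expectation p (h k) < 0"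
    by (elim exE conjE)
  then show ?thesis by (intro that(1)) auto
next
  case False
  define C where "C = {p. finite (set_pmf p) \<and> set_pmf p \<subseteq> T}"
  define a where "a k p = measure_pmf.expectation p (h k)" for k p
  have mix: "affinely_convexlike C a I"
    unfolding affinely_convexlike_def
  proof (intro ballI)
    fix u v \<theta> assume uv: "u \<in> C" "v \<in> C" and \<theta>: "\<theta> \<in> {0..1::real}"
    define m where "m = bernoulli_pmf \<theta> \<bind> (\<lambda>b. if b then v else u)"
    have "m \<in> C" using uv by (auto simp: C_def m_def split: if_splits)
    moreover have "a k m = (1 - \<theta>) * a k u + \<theta> * a k v" for k
      unfolding a_def m_def using uv \<theta>
      by (subst pmf_expectation_bind[of UNIV]) (auto simp: C_def UNIV_bool)
    ultimately show "\<exists>m\<in>C. \<forall>k\<in>I. a k m = (1 - \<theta>) * a k u + \<theta> * a k v" by blast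
  qed
  have "\<exists>\<beta>. (\<forall>k\<in>I. 0 \<le> \<beta> k) \<and> (\<Sum>k\<in>I. \<beta> k) = 1 \<and> (\<forall>p\<in>C. 0 \<le> (\<Sum>k\<in>I. \<beta> k * a k p))"
    using False by (intro finite_alternative[OF I mix]) (auto simp: C_def a_def not_less)
  then obtain \<beta> where \<beta>: "\<forall>k\<in>I. 0 \<le> \<beta> k" "(\<Sum>k\<in>I. \<beta> k) = 1"
    "\<forall>p\<in>C. 0 \<le> (\<Sum>k\<in>I. \<beta> k * a k p)"
    by (elim exE conjE)
  have "0 \<le> (\<Sum>k\<in>I. \<beta> k * h k t)" if "t \<in> T" for t
    using \<beta>(3)[rule_format, of "return_pmf t"] that by (simp add: C_def a_def)
  with \<beta>(1,2) show ?thesis by (intro that(2)[of \<beta>]) auto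
qed

text \<open>Laws on \<open>[0,1]\<close> are tight, so Helly's selection theorem applies.\<close>

lemma pmf_unit_interval_convergent_subsequence:
  fixes P :: "nat \<Rightarrow> real pmf"
  assumes P: "\<And>n. set_pmf (P n) \<subseteq> {0..1}"
  obtains r \<nu> where "strict_mono (r :: nat \<Rightarrow> nat)" "real_distribution \<nu>"
    "\<And>(f :: real \<Rightarrow> real) b. \<lbrakk>continuous_on UNIV f; \<And>t. \<bar>f t\<bar> \<le> b\<rbrakk>
      \<Longrightarrow> (\<lambda>n. measure_pmf.expectation (P (r n)) f) \<longlonglongrightarrow> (\<integral>t. f t \<partial>\<nu>)"
proof -
  define m where "m n = distr (measure_pmf (P n)) borel (\<lambda>t. t)" for n
  have rd: "real_distribution (m n)" for n
    unfolding m_def by (intro prob_space.real_distribution_distr prob_space_measure_pmf) simp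
  have "measure (m n) {-1<..1} = 1" for n
  proof -
    have "measure (m n) {-1<..1} = measure (measure_pmf (P n)) {-1<..1}"
      unfolding m_def by (subst measure_distr) auto
    also have "\<dots> = 1"
      using P[of n] by (subst measure_pmf.prob_eq_1) (auto intro!: AE_pmfI)
    finally show ?thesis .
  qed
  then have "tight m"
    unfolding tight_def using rd
    by (intro conjI allI impI exI[of _ "-1::real"] exI[of _ "1::real"]) simp_all
  from tight_imp_convergent_subsubsequence[OF this strict_mono_id]
  obtain r \<nu> where r: "strict_mono r" and \<nu>: "real_distribution \<nu>"
    and conv: "weak_conv_m (\<lambda>n. m (r n)) \<nu>"
    by (auto simp: o_def)
  show ?thesis
  proof (rule that[OF r \<nu>])
    fix f :: "real \<Rightarrow> real" and b assume f: "continuous_on UNIV f" "\<And>t. \<bar>f t\<bar> \<le> b"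
    have "(\<lambda>n. \<integral>t. f t \<partial>m (r n)) \<longlonglongrightarrow> (\<integral>t. f t \<partial>\<nu>)"
      using f by (intro weak_conv_imp_integral_bdd_continuous_conv[OF rd \<nu> conv, of _ b])
        (auto simp: continuous_on_eq_continuous_at)
    moreover have "(\<integral>t. f t \<partial>m n) = measure_pmf.expectation (P n) f" for n
      unfolding m_def using borel_measurable_continuous_onI[OF f(1)] by (subst integral_distr) auto
    ultimately show "(\<lambda>n. measure_pmf.expectation (P (r n)) f) \<longlonglongrightarrow> (\<integral>t. f t \<partial>\<nu>)" by simp
  qed
qed

lemma convex_on_finite_sum:
  fixes f :: "'i \<Rightarrow> 'a::real_vector \<Rightarrow> real"
  assumes "convex S" "\<And>i. i \<in> A \<Longrightarrow> convex_on S (f i)"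
  shows "convex_on S (\<lambda>x. \<Sum>i\<in>A. f i x)"
  using assms(2)
  by (induction A rule: infinite_finite_induct) (auto simp: convex_on_const assms(1) intro!: convex_on_add)

section \<open>Strong duality\<close>

context barycentric_transport
begin

text \<open>The sign unifies the two kinds of constraints: \<open>order_sign i * f\<close> has to gain mass under the
  \<open>i\<close>-th marginal, for every convex \<open>f\<close>.\<close>

definition order_sign :: "nat \<Rightarrow> real" where "order_sign i = (if i \<le> M then 1 else - 1)"

lemma plans_iff:
  "\<gamma> \<in> plans \<Omega> M N \<mu> \<longleftrightarrow> \<gamma> \<in> borel_probs_prod \<Omega> N \<and>
    (\<forall>i\<in>{1..N}. \<forall>f. convex_on UNIV f \<longrightarrow>
      order_sign i * (\<integral>x. f x \<partial>\<mu> i) \<le> order_sign i * (\<integral>x. f x \<partial>marginal \<Omega> i \<gamma>))"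
    (is "_ \<longleftrightarrow> _ \<and> (\<forall>i\<in>_. ?P i)")
proof -
  have "(\<forall>i\<in>{1..N}. ?P i) \<longleftrightarrow> (\<forall>i\<in>{1..M}. ?P i) \<and> (\<forall>i\<in>{M+1..N}. ?P i)"
    using M_le by auto
  also have "(\<forall>i\<in>{1..M}. ?P i) \<longleftrightarrow> (\<forall>i\<in>{1..M}. cx_le (\<mu> i) (marginal \<Omega> i \<gamma>))"
    by (intro ball_cong) (auto simp: cx_le_def order_sign_def)
  also have "(\<forall>i\<in>{M+1..N}. ?P i) \<longleftrightarrow> (\<forall>i\<in>{M+1..N}. cx_le (marginal \<Omega> i \<gamma>) (\<mu> i))"
    by (intro ball_cong) (auto simp: cx_le_def order_sign_def)
  finally show ?thesis by (auto simp: plans_def)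
qed

text \<open>Potentials that are built from real convex functions on the whole space. They are continuous, so
  semicontinuity and integrability are automatic. The constant \<open>d\<close> is shared by all \<open>N\<close> potentials.\<close>

lemma convex_dual_admissible:
  assumes g: "\<And>i. i \<in> {1..N} \<Longrightarrow> convex_on UNIV (g i)"
    and le: "\<And>x. (\<And>i. x i \<in> \<Omega>) \<Longrightarrow> (\<Sum>i=1..N. order_sign i * g i (x i) + d) \<le> c x"
  defines "\<phi> \<equiv> \<lambda>i x. ereal (order_sign i * g i x + d)"
  shows "\<phi> \<in> dual_admissible \<Omega> M N w p \<mu>"
    and "dual_value \<Omega> M N \<mu> \<phi> = ereal (\<Sum>i=1..N. order_sign i * (\<integral>x. g i x \<partial>\<mu> i) + d)"
proof -
  have cont: "continuous_on A (g i)" "continuous_on A (\<lambda>x. order_sign i * g i x + d)" if "i \<in> {1..N}" for A i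
    using continuous_on_convex_UNIV[OF g[OF that]] by (auto intro!: continuous_intros)
  have L1: "ereal_L1_on (K i) (\<phi> i) (\<mu> i)" if i: "i \<in> {1..N}" for i
    using pot_dom[OF i] by (intro ereal_L1_on_continuous[OF \<mu>[OF i] _ _ cont(2)[OF i]]) (auto simp: \<phi>_def)
  show "\<phi> \<in> dual_admissible \<Omega> M N w p \<mu>"
    unfolding dual_admissible_def
  proof (intro CollectI conjI ballI)
    fix i assume i: "i \<in> {1..M}"
    then have iN: "i \<in> {1..N}" using M_le by auto
    have "convex_on \<Omega> (\<lambda>x. g i x + d)"
      using convex_on_subset[OF g[OF iN], of \<Omega>] convex_\<Omega>
      by (intro convex_on_add) (auto simp: convex_on_const)
    moreover have "continuous_on \<Omega> (\<lambda>x. g i x + d)" by (intro continuous_intros cont(1)[OF iN])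
    ultimately show "\<exists>f. convex_on \<Omega> f \<and> continuous_on \<Omega> f \<and> (\<forall>x\<in>\<Omega>. \<phi> i x = ereal (f x))"
      using i by (intro exI[of _ "\<lambda>x. g i x + d"]) (auto simp: \<phi>_def order_sign_def)
  next
    fix i assume i: "i \<in> {M+1..N}"
    then have iN: "i \<in> {1..N}" by auto
    show "\<phi> i x \<noteq> \<infinity>" for x by (simp add: \<phi>_def)
    show "ereal_L1_on (K i) (\<phi> i) (\<mu> i)" by (rule L1[OF iN])
    show "ereal_concave_on (K i) (\<phi> i)"
      unfolding ereal_concave_on_def
    proof (intro conjI ballI pot_dom(2)[OF iN])
      fix x y t assume t: "t \<in> {0<..<1::real}"
      have "g i ((1 - t) *\<^sub>R x + t *\<^sub>R y) \<le> (1 - t) * g i x + t * g i y"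
        using convex_onD[OF g[OF iN], of t x y] t by simp
      then show "ereal (1 - t) * \<phi> i x + ereal t * \<phi> i y \<le> \<phi> i ((1 - t) *\<^sub>R x + t *\<^sub>R y)"
        using i by (simp add: \<phi>_def order_sign_def algebra_simps)
    qed
    show "ereal_usc_on (K i) (\<phi> i)"
      unfolding ereal_usc_on_def
    proof
      fix x assume "x \<in> K i"
      then have "(\<phi> i \<longlongrightarrow> \<phi> i x) (at x within K i)"
        unfolding \<phi>_def using cont(2)[OF iN, of "K i"] by (intro tendsto_ereal) (auto simp: continuous_on_def)
      then show "Limsup (at x within K i) (\<phi> i) \<le> \<phi> i x"
        unfolding Limsup_le_iff by (auto intro: order_tendstoD)
    qed
  next
    fix x assume "x \<in> (\<Pi>\<^sub>E i\<in>{1..N}. K i)"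
    then have x: "x i \<in> \<Omega>" if "i \<in> {1..N}" for i using that pot_dom(3)[OF that] by (auto simp: PiE_iff)
    obtain z where z: "z \<in> \<Omega>" using \<Omega>_nonempty by auto
    define x' where "x' i = (if i \<in> {1..N} then x i else z)" for i
    have "(\<Sum>i=1..N. order_sign i * g i (x' i) + d) \<le> c x'"
      by (rule le) (use x z in \<open>auto simp: x'_def\<close>)
    moreover have "c x' = c x" by (rule cbar_cong) (simp add: x'_def)
    ultimately show "(\<Sum>i=1..N. \<phi> i (x i)) \<le> ereal (c x)" by (simp add: \<phi>_def x'_def)
  qed
  have "ereal_integral_on (K i) (\<phi> i) (\<mu> i) = ereal (order_sign i * (\<integral>x. g i x \<partial>\<mu> i) + d)"
    if i: "i \<in> {1..N}" for i
  proof -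
    interpret prob_space "\<mu> i" by (rule borel_probsD(1)[OF \<mu>[OF i]])
    have Ks: "K i \<in> sets (\<mu> i)" by (rule sets_borel_probs_compact[OF \<mu>[OF i] pot_dom(1,3)[OF i]])
    have int: "integrable (\<mu> i) (g i)" "integrable (\<mu> i) (\<lambda>x. order_sign i * g i x + d)"
      by (intro integrable_borel_probs[OF \<mu>[OF i] compact_\<Omega>] cont i)+
    have "(\<integral>x. real_part_on (K i) (\<phi> i) x \<partial>\<mu> i) = (\<integral>x. order_sign i * g i x + d \<partial>\<mu> i)"
      using pot_dom(4)[OF i]
      by (intro integral_cong_AE borel_measurable_integrable ereal_L1_onD(1)[OF Ks L1[OF i]] int(2))
         (auto simp: real_part_on_def \<phi>_def)
    also have "\<dots> = order_sign i * (\<integral>x. g i x \<partial>\<mu> i) + d"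
      using int(1) by (simp add: prob_space)
    finally show ?thesis using ereal_L1_onD(2)[OF Ks L1[OF i]] by simp
  qed
  then show "dual_value \<Omega> M N \<mu> \<phi> = ereal (\<Sum>i=1..N. order_sign i * (\<integral>x. g i x \<partial>\<mu> i) + d)"
    by (simp add: dual_value_def)
qed

text \<open>The tests are indexed by pairs \<open>(k, i)\<close> and the cost bound by \<open>None\<close>. The second case of the
  alternative yields multipliers whose test functions are dual potentials of value at least \<open>V\<close>,
  contrary to the choice of \<open>V\<close>.\<close>

lemma approximate_plan:
  fixes F :: "nat \<Rightarrow> 'a \<Rightarrow> real" and n :: nat
  assumes feasible: "\<gamma>\<^sub>0 \<in> plans \<Omega> M N \<mu>" and V: "wDr \<Omega> M N w p \<mu> < ereal V" and \<delta>: "0 < \<delta>"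
    and G: "\<And>x. \<forall>i. x i \<in> \<Omega> \<Longrightarrow> \<exists>t\<in>{0..1}. \<forall>i. G i t = x i"
    and F: "\<And>k. convex_on UNIV (F k)"
  obtains P where "finite (set_pmf P)" "set_pmf P \<subseteq> {0..1::real}"
    "measure_pmf.expectation P (\<lambda>t. c (\<lambda>i. G i t)) \<le> V"
    "\<And>k i. \<lbrakk>k < n; i \<in> {1..N}\<rbrakk> \<Longrightarrow>
      order_sign i * (\<integral>x. F k x \<partial>\<mu> i) - \<delta> \<le> measure_pmf.expectation P (\<lambda>t. order_sign i * F k (G i t))"
proof -
  define I where "I = insert None (Some ` ({..<n} \<times> {1..N}))"
  define m where "m k i = order_sign i * (\<integral>x. F k x \<partial>\<mu> i)" for k i
  define h where "h j t = (case j of None \<Rightarrow> c (\<lambda>i. G i t) - V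
      | Some (k, i) \<Rightarrow> m k i - \<delta> - order_sign i * F k (G i t))" for j t
  have h: "h None = (\<lambda>t. c (\<lambda>i. G i t) - V)"
    "h (Some (k, i)) = (\<lambda>t. m k i - \<delta> - order_sign i * F k (G i t))" for k i
    by (auto simp: h_def)
  have I: "finite I" "I \<noteq> {}" by (auto simp: I_def)
  have sum_I: "(\<Sum>j\<in>I. u j) = u None + (\<Sum>k<n. \<Sum>i=1..N. u (Some (k, i)))" for u :: "_ \<Rightarrow> real"
    unfolding I_def by (subst sum.insert) (auto simp: sum.reindex sum.cartesian_product)
  show ?thesis
  proof (rule finite_support_alternative[OF I, of "{0..1}" h])
    fix P assume P: "finite (set_pmf P)" "set_pmf P \<subseteq> {0..1}"
      and neg: "\<And>j. j \<in> I \<Longrightarrow> measure_pmf.expectation P (h j) < 0"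
    have int: "integrable (measure_pmf P) f" for f :: "real \<Rightarrow> real"
      by (rule integrable_measure_pmf_finite[OF P(1)])
    show thesis
    proof (rule that[OF P])
      show "measure_pmf.expectation P (\<lambda>t. c (\<lambda>i. G i t)) \<le> V"
        using neg[of None] int by (simp add: I_def h)
      show "order_sign i * (\<integral>x. F k x \<partial>\<mu> i) - \<delta> \<le> measure_pmf.expectation P (\<lambda>t. order_sign i * F k (G i t))"
        if "k < n" "i \<in> {1..N}" for k i
        using neg[of "Some (k, i)"] int that by (simp add: I_def h m_def)
    qed
  next
    fix \<beta> assume \<beta>: "\<And>j. j \<in> I \<Longrightarrow> 0 \<le> \<beta> j" "(\<Sum>j\<in>I. \<beta> j) = 1"
      "\<And>t. t \<in> {0..1} \<Longrightarrow> 0 \<le> (\<Sum>j\<in>I. \<beta> j * h j t)"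
    define b where "b k i = \<beta> (Some (k, i))" for k i
    have b0: "0 \<le> b k i" if "k < n" "i \<in> {1..N}" for k i
      using \<beta>(1) that by (auto simp: b_def I_def)
    have key: "(\<Sum>k<n. \<Sum>i=1..N. b k i * (order_sign i * F k (x i)))
        \<le> \<beta> None * (c x - V) + (\<Sum>k<n. \<Sum>i=1..N. b k i * (m k i - \<delta>))" if x: "\<And>i. x i \<in> \<Omega>" for x
    proof -
      obtain t where t: "t \<in> {0..1}" "\<forall>i. G i t = x i" using G[of x] x by blast
      have "0 \<le> \<beta> None * (c x - V) + (\<Sum>k<n. \<Sum>i=1..N. b k i * (m k i - \<delta> - order_sign i * F k (x i)))"
        using \<beta>(3)[OF t(1)] t(2) unfolding sum_I by (simp add: h_def b_def)
      also have "(\<Sum>k<n. \<Sum>i=1..N. b k i * (m k i - \<delta> - order_sign i * F k (x i)))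
          = (\<Sum>k<n. \<Sum>i=1..N. b k i * (m k i - \<delta>)) - (\<Sum>k<n. \<Sum>i=1..N. b k i * (order_sign i * F k (x i)))"
        by (simp add: right_diff_distrib sum_subtractf)
      finally show ?thesis by simp
    qed
    \<comment> \<open>If the cost had weight \<open>0\<close>, integration of the pointwise inequality against the feasible plan
      would contradict the slack \<open>\<delta>\<close>.\<close>
    have \<beta>0: "0 < \<beta> None"
    proof (rule ccontr)
      assume "\<not> 0 < \<beta> None"
      then have zero: "\<beta> None = 0" using \<beta>(1)[of None] by (simp add: I_def)
      have sum_b: "(\<Sum>k<n. \<Sum>i=1..N. b k i) = 1" using \<beta>(2) zero by (simp add: sum_I b_def)
      note \<gamma>\<^sub>0 = feasible[unfolded plans_iff]
      interpret prob_space \<gamma>\<^sub>0 by (rule plansD[OF feasible])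
      have meas: "F k \<in> borel_measurable (marginal \<Omega> i \<gamma>\<^sub>0)" "integrable (marginal \<Omega> i \<gamma>\<^sub>0) (F k)"
        if "i \<in> {1..N}" for k i
        using that \<gamma>\<^sub>0 by (auto intro!: borel_measurable_borel_probs integrable_borel_probs
            marginal_borel_probs continuous_on_convex_UNIV F compact_\<Omega>)
      have int: "integrable \<gamma>\<^sub>0 (\<lambda>x. F k (x i))" if i: "i \<in> {1..N}" for k i
        using meas(2)[OF i] unfolding marginal_def
        by (rule integrable_distr[OF measurable_plan_coordinate[OF conjunct1[OF \<gamma>\<^sub>0] i]])
      have "(\<Sum>k<n. \<Sum>i=1..N. b k i * m k i)
          \<le> (\<Sum>k<n. \<Sum>i=1..N. b k i * (order_sign i * (\<integral>x. F k (x i) \<partial>\<gamma>\<^sub>0)))"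
        using \<gamma>\<^sub>0 F by (intro sum_mono mult_left_mono b0)
          (auto simp: m_def integral_marginal[OF conjunct1[OF \<gamma>\<^sub>0] _ meas(1), symmetric])
      also have "\<dots> = (\<integral>x. (\<Sum>k<n. \<Sum>i=1..N. b k i * (order_sign i * F k (x i))) \<partial>\<gamma>\<^sub>0)"
      proof -
        have int': "integrable \<gamma>\<^sub>0 (\<lambda>x. b k i * (order_sign i * F k (x i)))" if "i \<in> {1..N}" for k i
          using int[OF that] by (intro integrable_mult_right)
        have "(\<integral>x. (\<Sum>k<n. \<Sum>i=1..N. b k i * (order_sign i * F k (x i))) \<partial>\<gamma>\<^sub>0)
            = (\<Sum>k<n. \<integral>x. (\<Sum>i=1..N. b k i * (order_sign i * F k (x i))) \<partial>\<gamma>\<^sub>0)"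
          by (intro Bochner_Integration.integral_sum Bochner_Integration.integrable_sum int')
        also have "\<dots> = (\<Sum>k<n. \<Sum>i=1..N. \<integral>x. b k i * (order_sign i * F k (x i)) \<partial>\<gamma>\<^sub>0)"
          by (intro sum.cong refl Bochner_Integration.integral_sum int')
        finally show ?thesis by simp
      qed
      also have "\<dots> \<le> (\<integral>x. (\<Sum>k<n. \<Sum>i=1..N. b k i * (m k i - \<delta>)) \<partial>\<gamma>\<^sub>0)"
      proof (intro integral_mono)
        show "integrable \<gamma>\<^sub>0 (\<lambda>x. \<Sum>k<n. \<Sum>i=1..N. b k i * (order_sign i * F k (x i)))"
          using int by (intro Bochner_Integration.integrable_sum integrable_mult_right) auto
        fix x assume x: "x \<in> space \<gamma>\<^sub>0"
        obtain z where z: "z \<in> \<Omega>" using \<Omega>_nonempty by auto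
        define x' where "x' i = (if i \<in> {1..N} then x i else z)" for i
        have x': "x' i \<in> \<Omega>" for i using x z by (auto simp: x'_def plansD(3)[OF feasible] PiE_iff)
        with key[of x'] show "(\<Sum>k<n. \<Sum>i=1..N. b k i * (order_sign i * F k (x i)))
            \<le> (\<Sum>k<n. \<Sum>i=1..N. b k i * (m k i - \<delta>))"
          by (simp add: zero x'_def cong: sum.cong_simp)
      qed simp
      also have "\<dots> = (\<Sum>k<n. \<Sum>i=1..N. b k i * m k i) - (\<Sum>k<n. \<Sum>i=1..N. b k i) * \<delta>"
        by (simp add: prob_space right_diff_distrib sum_subtractf sum_distrib_right)
      finally show False using \<delta> sum_b by simp
    qed
    \<comment> \<open>Dividing by the weight of the cost, the pointwise inequality becomes the dual constraint with
      additive constant \<open>N d\<close>.\<close>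
    define d where "d = (V - (\<Sum>k<n. \<Sum>i=1..N. b k i * (m k i - \<delta>)) / \<beta> None) / real N"
    define g where "g i x = (\<Sum>k<n. b k i / \<beta> None * F k x)" for i x
    have split: "(\<Sum>i=1..N. order_sign i * (\<Sum>k<n. b k i / \<beta> None * a k i) + d)
        = (\<Sum>k<n. \<Sum>i=1..N. b k i * (order_sign i * a k i)) / \<beta> None + V
          - (\<Sum>k<n. \<Sum>i=1..N. b k i * (m k i - \<delta>)) / \<beta> None" for a :: "nat \<Rightarrow> nat \<Rightarrow> real"
    proof -
      have "(\<Sum>i=1..N. order_sign i * (\<Sum>k<n. b k i / \<beta> None * a k i))
          = (\<Sum>i=1..N. \<Sum>k<n. b k i * (order_sign i * a k i) / \<beta> None)"
        by (simp add: sum_distrib_left algebra_simps)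
      also have "\<dots> = (\<Sum>k<n. \<Sum>i=1..N. b k i * (order_sign i * a k i)) / \<beta> None"
        by (subst sum.swap) (simp add: sum_divide_distrib)
      finally show ?thesis using N_pos by (simp add: sum.distrib d_def)
    qed
    have cvx: "convex_on UNIV (g i)" if "i \<in> {1..N}" for i
      unfolding g_def
    proof (intro convex_on_finite_sum convex_UNIV)
      fix k assume "k \<in> {..<n}"
      then have "0 \<le> b k i / \<beta> None" using b0 that \<beta>0 by simp
      then show "convex_on UNIV (\<lambda>x. b k i / \<beta> None * F k x)" by (rule convex_on_cmul[OF _ F])
    qed
    have le: "(\<Sum>i=1..N. order_sign i * g i (x i) + d) \<le> c x" if x: "\<And>i. x i \<in> \<Omega>" for x
      unfolding g_def split[of "\<lambda>k i. F k (x i)"]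
      using divide_right_mono[OF key[of x] less_imp_le[OF \<beta>0]] \<beta>0 x
      by (simp add: add_divide_distrib)
    define \<phi> where "\<phi> i x = ereal (order_sign i * g i x + d)" for i x
    have adm: "\<phi> \<in> dual_admissible \<Omega> M N w p \<mu>"
      and val: "dual_value \<Omega> M N \<mu> \<phi> = ereal (\<Sum>i=1..N. order_sign i * (\<integral>x. g i x \<partial>\<mu> i) + d)"
      unfolding \<phi>_def by (intro convex_dual_admissible cvx le; assumption)+
    have "(\<integral>x. g i x \<partial>\<mu> i) = (\<Sum>k<n. b k i / \<beta> None * (\<integral>x. F k x \<partial>\<mu> i))" if i: "i \<in> {1..N}" for i
    proof -
      have int: "integrable (\<mu> i) (\<lambda>x. b k i / \<beta> None * F k x)" for k
        by (intro integrable_mult_right integrable_borel_probs[OF \<mu>[OF i] compact_\<Omega>]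
              continuous_on_convex_UNIV F)
      have "(\<integral>x. g i x \<partial>\<mu> i) = (\<Sum>k<n. \<integral>x. b k i / \<beta> None * F k x \<partial>\<mu> i)"
        unfolding g_def by (intro Bochner_Integration.integral_sum int)
      then show ?thesis by (simp only: integral_mult_right_zero)
    qed
    then have "(\<Sum>i=1..N. order_sign i * (\<integral>x. g i x \<partial>\<mu> i) + d)
        = (\<Sum>i=1..N. order_sign i * (\<Sum>k<n. b k i / \<beta> None * (\<integral>x. F k x \<partial>\<mu> i)) + d)"
      by simp
    also have "\<dots> = V + (\<Sum>k<n. \<Sum>i=1..N. b k i * \<delta>) / \<beta> None"
      unfolding split[of "\<lambda>k i. \<integral>x. F k x \<partial>\<mu> i"]
      by (simp add: m_def[symmetric] right_diff_distrib sum_subtractf diff_divide_distrib)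
    also have "\<dots> \<ge> V"
      using \<beta>0 \<delta> b0 by (auto intro!: divide_nonneg_pos sum_nonneg mult_nonneg_nonneg)
    finally have "ereal V \<le> dual_value \<Omega> M N \<mu> \<phi>"
      unfolding val by simp
    also have "\<dots> \<le> wDr \<Omega> M N w p \<mu>"
      unfolding wDr_def by (rule SUP_upper[OF adm])
    finally show thesis using V by simp
  qed
qed

text \<open>A number strictly between the two values would bound the cost of a plan, namely of a weak limit
  of approximate plans for more and more tests.\<close>

lemma strong_duality:
  assumes feasible: "\<gamma>\<^sub>0 \<in> plans \<Omega> M N \<mu>"
  shows "wMM \<Omega> M N w p \<mu> \<le> wDr \<Omega> M N w p \<mu>"
proof (rule ccontr)
  assume "\<not> wMM \<Omega> M N w p \<mu> \<le> wDr \<Omega> M N w p \<mu>"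
  then obtain V where V: "wDr \<Omega> M N w p \<mu> < ereal V" "ereal V < wMM \<Omega> M N w p \<mu>"
    using ereal_dense2[of "wDr \<Omega> M N w p \<mu>" "wMM \<Omega> M N w p \<mu>"] by (auto simp: not_le)
  obtain G :: "nat \<Rightarrow> real \<Rightarrow> 'a" where G: "\<And>i. continuous_on UNIV (G i)" "\<And>i t. G i t \<in> \<Omega>"
    "\<And>x. \<forall>i. x i \<in> \<Omega> \<Longrightarrow> \<exists>t\<in>{0..1}. \<forall>i. G i t = x i"
  proof (rule compact_convex_curve[OF compact_\<Omega> convex_\<Omega> \<Omega>_nonempty], goal_cases)
    case (1 G)
    from 1(2-4) show ?thesis by (rule 1(1))
  qed
  have zero: "convex_on UNIV (\<lambda>_::'a. 0::real)" by (simp add: convex_on_const)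
  obtain F :: "nat \<Rightarrow> 'a \<Rightarrow> real" where F: "\<And>k. convex_on UNIV (F k)"
    and F_dense: "\<And>f e. convex_on UNIV f \<Longrightarrow> 0 < e \<Longrightarrow> \<exists>k. \<forall>x\<in>\<Omega>. \<bar>F k x - f x\<bar> \<le> e"
  proof (rule countable_uniformly_dense[where P="convex_on UNIV", OF compact_\<Omega> _ zero], goal_cases)
    case (1 f)
    from 1(2) show ?case by (rule continuous_on_convex_UNIV)
  next
    case (2 F)
    from 2(2-3) show ?thesis by (rule 2(1))
  qed
  have "\<exists>P. set_pmf P \<subseteq> {0..1::real} \<and> measure_pmf.expectation P (\<lambda>t. c (\<lambda>i. G i t)) \<le> V \<and>
      (\<forall>k<n. \<forall>i\<in>{1..N}. order_sign i * (\<integral>x. F k x \<partial>\<mu> i) - inverse (Suc n)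
        \<le> measure_pmf.expectation P (\<lambda>t. order_sign i * F k (G i t)))" for n
    by (rule approximate_plan[OF feasible V(1), where \<delta>="inverse (Suc n)" and F=F and n=n, OF _ G(3) F])
       auto
  then obtain P where P: "\<And>n. set_pmf (P n) \<subseteq> {0..1::real}"
    "\<And>n. measure_pmf.expectation (P n) (\<lambda>t. c (\<lambda>i. G i t)) \<le> V"
    "\<And>n k i. \<lbrakk>k < n; i \<in> {1..N}\<rbrakk> \<Longrightarrow> order_sign i * (\<integral>x. F k x \<partial>\<mu> i) - inverse (Suc n)
        \<le> measure_pmf.expectation (P n) (\<lambda>t. order_sign i * F k (G i t))"
    by metis
  obtain r \<nu> where r: "strict_mono (r :: nat \<Rightarrow> nat)" and \<nu>: "real_distribution \<nu>"
    and lim: "\<And>(f :: real \<Rightarrow> real) b. \<lbrakk>continuous_on UNIV f; \<And>t. \<bar>f t\<bar> \<le> b\<rbrakk>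
      \<Longrightarrow> (\<lambda>n. measure_pmf.expectation (P (r n)) f) \<longlonglongrightarrow> (\<integral>t. f t \<partial>\<nu>)"
  proof (rule pmf_unit_interval_convergent_subsequence[where P=P, OF P(1)], goal_cases)
    case (1 r \<nu>)
    from 1(2-4) show ?thesis by (rule 1(1))
  qed
  interpret \<nu>: real_distribution \<nu> by fact
  define g where "g t = (\<lambda>i\<in>{1..N}. G i t)" for t
  \<comment> \<open>The limit law on the line is transported back to \<open>\<Omega>\<^sup>N\<close> along the curve.\<close>
  define \<gamma> where "\<gamma> = distr \<nu> (PiM {1..N} (\<lambda>_. restrict_space borel \<Omega>)) g"
  have G_meas: "G i \<in> \<nu> \<rightarrow>\<^sub>M restrict_space borel \<Omega>" for i
    using borel_measurable_continuous_onI[OF G(1)] G(2)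
    by (intro measurable_restrict_space2) (auto simp: measurable_cong_sets[OF \<nu>.events_eq_borel refl])
  have g_meas: "g \<in> \<nu> \<rightarrow>\<^sub>M PiM {1..N} (\<lambda>_. restrict_space borel \<Omega>)"
    unfolding g_def by (intro measurable_restrict G_meas)
  have \<gamma>': "\<gamma> \<in> borel_probs_prod \<Omega> N"
    unfolding borel_probs_prod_def \<gamma>_def using \<nu>.prob_space_distr[OF g_meas] by simp
  have marg: "marginal \<Omega> i \<gamma> = distr \<nu> (restrict_space borel \<Omega>) (G i)" if i: "i \<in> {1..N}" for i
  proof -
    have "marginal \<Omega> i \<gamma> = distr \<nu> (restrict_space borel \<Omega>) ((\<lambda>x. x i) \<circ> g)"
      unfolding marginal_def \<gamma>_def by (rule distr_distr[OF measurable_component_singleton[OF i] g_meas])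
    also have "(\<lambda>x. x i) \<circ> g = G i" using i by (auto simp: g_def)
    finally show ?thesis .
  qed
  have int_marg: "(\<integral>x. f x \<partial>marginal \<Omega> i \<gamma>) = (\<integral>t. f (G i t) \<partial>\<nu>)"
    if "i \<in> {1..N}" "convex_on UNIV f" for i and f :: "'a \<Rightarrow> real"
    unfolding marg[OF that(1)]
    by (intro integral_distr G_meas borel_measurable_continuous_on_restrict continuous_on_convex_UNIV that(2))
  have test: "order_sign i * (\<integral>x. F k x \<partial>\<mu> i) \<le> order_sign i * (\<integral>x. F k x \<partial>marginal \<Omega> i \<gamma>)"
    if i: "i \<in> {1..N}" for i k
  proof -
    obtain b where b: "\<And>x. x \<in> \<Omega> \<Longrightarrow> norm (F k x) \<le> b"
      using compact_imp_bounded[OF compact_continuous_image[OF continuous_on_convex_UNIV[OF F[of k]] compact_\<Omega>]]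
      by (auto simp: bounded_iff)
    have "(\<lambda>n. measure_pmf.expectation (P (r n)) (\<lambda>t. order_sign i * F k (G i t)))
        \<longlonglongrightarrow> (\<integral>t. order_sign i * F k (G i t) \<partial>\<nu>)"
    proof (rule lim)
      show "continuous_on UNIV (\<lambda>t. order_sign i * F k (G i t))"
        by (intro continuous_intros continuous_on_compose2[OF continuous_on_convex_UNIV[OF F] G(1)]) auto
      show "\<bar>order_sign i * F k (G i t)\<bar> \<le> b" for t
        using b[OF G(2)] by (simp add: order_sign_def)
    qed
    moreover have "(\<lambda>n. order_sign i * (\<integral>x. F k x \<partial>\<mu> i) - inverse (Suc (r n)))
        \<longlonglongrightarrow> order_sign i * (\<integral>x. F k x \<partial>\<mu> i) - 0"
      using LIMSEQ_subseq_LIMSEQ[OF LIMSEQ_inverse_real_of_nat r]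
      by (intro tendsto_intros) (simp add: o_def)
    moreover have "\<forall>\<^sub>F n in sequentially. order_sign i * (\<integral>x. F k x \<partial>\<mu> i) - inverse (Suc (r n))
        \<le> measure_pmf.expectation (P (r n)) (\<lambda>t. order_sign i * F k (G i t))"
      using eventually_gt_at_top[of k]
    proof eventually_elim
      fix n assume "k < n"
      then have "k < r n" using seq_suble[OF r, of n] by simp
      then show "order_sign i * (\<integral>x. F k x \<partial>\<mu> i) - inverse (Suc (r n))
        \<le> measure_pmf.expectation (P (r n)) (\<lambda>t. order_sign i * F k (G i t))"
        by (rule P(3)[OF _ i])
    qed
    ultimately have "order_sign i * (\<integral>x. F k x \<partial>\<mu> i) - 0 \<le> (\<integral>t. order_sign i * F k (G i t) \<partial>\<nu>)"
      by (intro tendsto_le[OF sequentially_bot])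
    then show ?thesis by (simp add: int_marg[OF i F])
  qed
  have "\<gamma> \<in> plans \<Omega> M N \<mu>"
    unfolding plans_iff
  proof (intro conjI \<gamma>' ballI allI impI)
    fix i and f :: "'a \<Rightarrow> real" assume i: "i \<in> {1..N}" and f: "convex_on UNIV f"
    show "order_sign i * (\<integral>x. f x \<partial>\<mu> i) \<le> order_sign i * (\<integral>x. f x \<partial>marginal \<Omega> i \<gamma>)"
    proof (rule field_le_epsilon)
      fix e :: real assume "0 < e"
      then obtain k where k: "\<And>x. x \<in> \<Omega> \<Longrightarrow> \<bar>F k x - f x\<bar> \<le> e / 2"
        using F_dense[OF f, of "e / 2"] by auto
      have close: "\<bar>(\<integral>x. F k x \<partial>\<rho>) - (\<integral>x. f x \<partial>\<rho>)\<bar> \<le> e / 2" if \<rho>: "\<rho> \<in> borel_probs \<Omega>" for \<rho>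
      proof -
        interpret prob_space \<rho> by (rule borel_probsD(1)[OF \<rho>])
        have int: "integrable \<rho> (F k)" "integrable \<rho> f"
          by (intro integrable_borel_probs[OF \<rho> compact_\<Omega>] continuous_on_convex_UNIV F f)+
        have "\<bar>(\<integral>x. F k x \<partial>\<rho>) - (\<integral>x. f x \<partial>\<rho>)\<bar> = \<bar>\<integral>x. F k x - f x \<partial>\<rho>\<bar>"
          using int by simp
        also have "\<dots> \<le> (\<integral>x. \<bar>F k x - f x\<bar> \<partial>\<rho>)" by (rule integral_abs_bound)
        also have "\<dots> \<le> (\<integral>x. e / 2 \<partial>\<rho>)"
          using int k borel_probsD(3)[OF \<rho>] by (intro integral_mono) auto
        finally show ?thesis by (simp add: prob_space)
      qed
      show "order_sign i * (\<integral>x. f x \<partial>\<mu> i) \<le> order_sign i * (\<integral>x. f x \<partial>marginal \<Omega> i \<gamma>) + e"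
        using test[OF i, of k] close[OF \<mu>[OF i]] close[OF marginal_borel_probs[OF \<gamma>' i]]
        by (cases "i \<le> M"; simp add: order_sign_def; linarith)
    qed
  qed
  moreover have "(\<integral>x. c x \<partial>\<gamma>) \<le> V"
  proof -
    obtain b where b: "\<And>x. (\<And>i. i \<in> {1..N} \<Longrightarrow> x i \<in> \<Omega>) \<Longrightarrow> norm (c x) \<le> b"
      using cbar_bounded by metis
    have "(\<lambda>n. measure_pmf.expectation (P (r n)) (\<lambda>t. c (\<lambda>i. G i t))) \<longlonglongrightarrow> (\<integral>t. c (\<lambda>i. G i t) \<partial>\<nu>)"
    proof (rule lim)
      show "continuous_on UNIV (\<lambda>t. c (\<lambda>i. G i t))" by (intro continuous_on_cbar G)
      show "\<bar>c (\<lambda>i. G i t)\<bar> \<le> b" for t using b[of "\<lambda>i. G i t"] G(2) by simp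
    qed
    then have "(\<integral>t. c (\<lambda>i. G i t) \<partial>\<nu>) \<le> V"
      by (rule tendsto_upperbound) (use P(2) in auto)
    moreover have "(\<integral>x. c x \<partial>\<gamma>) = (\<integral>t. c (g t) \<partial>\<nu>)"
      unfolding \<gamma>_def by (rule integral_distr[OF g_meas measurable_cbar])
    moreover have "c (g t) = c (\<lambda>i. G i t)" for t by (rule cbar_cong) (simp add: g_def)
    ultimately show ?thesis by simp
  qed
  ultimately have "wMM \<Omega> M N w p \<mu> \<le> ereal V"
    unfolding wMM_def by (intro INF_lower2) auto
  then show False using V(2) by simp
qed

lemma duality:
  assumes "\<gamma> \<in> plans \<Omega> M N \<mu>"
  shows "wMM \<Omega> M N w p \<mu> = wDr \<Omega> M N w p \<mu>"
proof (rule antisym[OF strong_duality[OF assms]])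
  show "wDr \<Omega> M N w p \<mu> \<le> wMM \<Omega> M N w p \<mu>"
    unfolding wDr_def wMM_def by (intro SUP_least INF_greatest weak_duality)
qed

end

section \<open>The equivalence\<close>

theorem lemma3p6:
  fixes \<Omega> :: "'a::euclidean_space set"
    and M N :: nat
    and p :: real
    and w :: "nat \<Rightarrow> real"
    and \<mu> :: "nat \<Rightarrow> 'a measure"
    and \<phi> :: "nat \<Rightarrow> 'a \<Rightarrow> ereal"
    and \<gamma> :: "(nat \<Rightarrow> 'a) measure"
  assumes "compact \<Omega>" and "convex \<Omega>"
    and "M \<le> N" and "N > 0"
    and "1 < p"
    and "\<And>i. i \<in> {1..N} \<Longrightarrow> \<mu> i \<in> borel_probs \<Omega>"
    and "\<And>i. i \<in> {1..N} \<Longrightarrow> w i \<in> {0<..<1}"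
    and "(\<Sum>i=1..N. w i) = 1"
    and "\<phi> \<in> dual_admissible \<Omega> M N w p \<mu>"
    and "\<gamma> \<in> plans \<Omega> M N \<mu>"
  shows "(wMM_minimizer \<Omega> M N w p \<mu> \<gamma> \<and> wDr_maximizer \<Omega> M N w p \<mu> \<phi>) \<longleftrightarrow>
    ((AE x in \<gamma>. (\<forall>i\<in>{1..N}. x i \<in> pot_dom \<Omega> M \<mu> i) \<and>
        (\<Sum>i=1..N. \<phi> i (x i)) = ereal (cbar \<Omega> N w p x)) \<and>
     (\<forall>i\<in>{1..N}. ereal_integral_on (pot_dom \<Omega> M \<mu> i) (\<phi> i) (marginal \<Omega> i \<gamma>) =
        ereal_integral_on (pot_dom \<Omega> M \<mu> i) (\<phi> i) (\<mu> i)))"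
proof -
  interpret barycentric_transport \<Omega> M N w p \<mu>
    by unfold_locales (fact assms)+
  have lower: "dual_value \<Omega> M N \<mu> \<phi> \<le> wDr \<Omega> M N w p \<mu>"
    unfolding wDr_def by (rule SUP_upper[OF assms(9)])
  have upper: "wMM \<Omega> M N w p \<mu> \<le> ereal (\<integral>x. cbar \<Omega> N w p x \<partial>\<gamma>)"
    unfolding wMM_def by (rule INF_lower[OF assms(10)])
  have "(wMM_minimizer \<Omega> M N w p \<mu> \<gamma> \<and> wDr_maximizer \<Omega> M N w p \<mu> \<phi>) \<longleftrightarrow>
      dual_value \<Omega> M N \<mu> \<phi> = ereal (\<integral>x. cbar \<Omega> N w p x \<partial>\<gamma>)"
    unfolding wMM_minimizer_def wDr_maximizer_def
    using assms(9,10) duality[OF assms(10)] lower upper by (auto intro: antisym)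
  also note complementary_slackness[OF assms(9,10)]
  finally show ?thesis .
qed

end
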